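(* The transformation $\Phi:K_{diag}\circ\iota_a\to\iota_s\circ K_{sig}$ between functors $Sig_a\to\mathcal{A}n\mathcal{D}iag$, whose component at $(A,\partial^A,O)$ is the morphism of analytic diagrams $(\Phi_0,\Phi_1,1_O)$ with $\Phi_0(a,h)=\langle a,\pi_2\circ h\rangle$ and $\Phi_1(a,h,i)=\langle a,\pi_2\circ h,i\rangle$ (where $\pi_2(a,i)=i$), is a natural isomorphism.
   Context: Notation: $[n]=\{0,\dots,n\}$, $(n]=\{1,\dots,n\}$; $S_n$ is the group of permutations of $(n]$, acting on $[n]$ with $0$ fixed. $Sig_a$. Objects $(A,\partial^A,O)$: sets $A,O$ with, for $a\in A$, $|a|\in\omega$ and $\partial^A_a:[|a|]\to O$. Morphisms $(f,\sigma,u):(A,\partial^A,O)\to(B,\partial^B,Q)$: $f:A\to B$, $u:O\to Q$, $\sigma_a\in S_{|a|}$ with $|f(a)|=|a|$ and $u\circ\partial^A_a\circ\sigma_a=\partial^B_{f(a)}$; $(g,\tau,v)(f,\sigma,u)=(gf,(\sigma_a\tau_{f(a)})_a,vu)$. $\mathcal{P}oly\mathcal{D}iag$. Objects over $O$: diagrams of sets $O\xleftarrow{s}E\xrightarrow{p}A\xrightarrow{t}O$, $p$ with finite fibres. Morphisms over $u:O\to Q$: $(f,g,u)$ with $f:A\to A'$, $g:E\to E'$, $s'g=us$, $t'f=ut$, and $p'g=fp$ a pullback. Symmetric sets and $Sig_s$. A symmetric set $(A,\alpha)$ is a family $(A_n)_{n\in\omega}$ with right $S_n$-actions $a\cdot\sigma$;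 $|a|=n$ for $a\in A_n$; morphisms are equivariant. $\delta(O)=\omega\times O$ with trivial actions. A symmetric signature $(A,\alpha,\partial^A,O)$ is a symmetric set with functions $\partial^A_a:[|a|]\to O$ such that $\partial^A_{a\cdot\sigma}=\partial^A_a\circ\sigma$; morphisms $(f,u)$ are equivariant $f$ with $\partial^B_{f(a)}=u\circ\partial^A_a$. $\mathcal{A}n\mathcal{D}iag$. Let $(R,\rho)$ be the symmetric set $R_n=\{n\}\times(n]$, $\langle n,i\rangle\cdot\tau=\langle n,\tau^{-1}(i)\rangle$. An analytic diagram over $O$ is a diagram $\delta(O)\xleftarrow{s}(E,\varepsilon)\xrightarrow{p}(A,\alpha)\xrightarrow{t}\delta(O)$ of symmetric sets with an equivariant map $(E,\varepsilon)\to(R,\rho)$ exhibiting $p$ as the pullback of $(R,\rho)\to\delta(1)$ along $(A,\alpha)\to\delta(1)$ ($\delta(1)$ is terminal). Morphisms over $u:O\to Q$: $(f,g,u)$ with $f,g$ equivariant, $s'g=\delta(u)s$, $t'f=\delta(u)t$, $p'g=fp$ a pullback, and $g$ compatible with the maps to $(R,\rho)$. Functors. $\iota_a$: $(A,\partial^A,O)\mapsto(O\xleftarrow{s^A}E^A\xrightarrow{p^A}A\xrightarrow{t^A}O)$ with $E^A=\{\langle a,i\rangle:i\in(|a|]\}$, $p^A(a,i)=a$, $s^A(a,i)=\partial^A_a(i)$, $t^A(a)=\partial^A_a(0)$; $(f,\sigma,u)\mapsto(f,g,u)$ with $g(a,i)=\langle f(a),\sigma_a^{-1}(i)\rangle$.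 $K_{sig}$: $(A,\partial^A,O)\mapsto(s(A),\alpha,\partial^{s(A)},O)$ with $s(A)=\{\langle a,\tau\rangle:a\in A,\tau\in S_{|a|}\}$ (graded by $|a|$), $\langle a,\tau\rangle\cdot\tau'=\langle a,\tau\tau'\rangle$, $\partial^{s(A)}_{\langle a,\tau\rangle}=\partial^A_a\circ\tau$; $(f,\sigma,u)\mapsto(s(f,\sigma),u)$, $s(f,\sigma)(a,\tau)=\langle f(a),\sigma_a^{-1}\circ\tau\rangle$. $\iota_s$: $(A,\alpha,\partial^A,O)\mapsto(\delta(O)\xleftarrow{s^A}(E^A,\overline{\alpha})\xrightarrow{p^A}(A,\alpha)\xrightarrow{t^A}\delta(O))$ with $E^A=\{\langle a,i\rangle:a\in A,\ i\in(|a|]\}$, $\langle a,i\rangle\cdot\sigma=\langle a\cdot\sigma,\sigma^{-1}(i)\rangle$, $s^A(a,i)=\langle|a|,\partial^A_a(i)\rangle$, $p^A(a,i)=a$, $t^A(a)=\langle|a|,\partial^A_a(0)\rangle$, map to $R$: $\langle a,i\rangle\mapsto\langle|a|,i\rangle$; $(f,u)\mapsto(f,\bar{f},u)$, $\bar{f}(a,i)=\langle f(a),i\rangle$. $K_{diag}$: $(O\xleftarrow{s}E\xrightarrow{p}A\xrightarrow{t}O)\mapsto(\delta(O)\xleftarrow{\tilde{s}}(\tilde{E},\tilde{\varepsilon})\xrightarrow{\tilde{p}}(\tilde{A},\tilde{\alpha})\xrightarrow{\tilde{t}}\delta(O))$ with, for $|a|$ the number of elements of $p^{-1}(a)$, $\tilde{A}=\{\langle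 a,h\rangle:a\in A,\ h:(|a|]\to p^{-1}(a)\text{ a bijection}\}$, $\tilde{E}=\{\langle a,h,i\rangle:\langle a,h\rangle\in\tilde{A},\ i\in(|a|]\}$, $\langle a,h\rangle\cdot\tau=\langle a,h\tau\rangle$, $\langle a,h,i\rangle\cdot\tau=\langle a,h\tau,\tau^{-1}(i)\rangle$, $\tilde{t}(a,h)=\langle|a|,t(a)\rangle$, $\tilde{p}(a,h,i)=\langle a,h\rangle$, $\tilde{s}(a,h,i)=\langle|a|,s(h(i))\rangle$, map to $R$: $\langle a,h,i\rangle\mapsto\langle|a|,i\rangle$; $(f,g,u)\mapsto(\tilde{f},\tilde{g},u)$ with $\tilde{f}(a,h)=\langle f(a),g|_{p^{-1}(a)}\circ h\rangle$, $\tilde{g}(a,h,i)=\langle f(a),g|_{p^{-1}(a)}\circ h,i\rangle$. *)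

theory Defs
  imports "HOL-Library.FuncSet" "HOL-Combinatorics.Permutations"
begin

text \<open>
  Arrows are indexed by their domain and codomain, so hom-sets need not be disjoint;
  composition is \<^term>\<open>cmp C X Y Z g f\<close> for \<open>f : X \<rightarrow> Y\<close>, \<open>g : Y \<rightarrow> Z\<close>.
\<close>

record ('ob, 'm) cat =
  Ob  :: "'ob set"
  Hom :: "'ob \<Rightarrow> 'ob \<Rightarrow> 'm set"
  cmp :: "'ob \<Rightarrow> 'ob \<Rightarrow> 'ob \<Rightarrow> 'm \<Rightarrow> 'm \<Rightarrow> 'm"
  ide :: "'ob \<Rightarrow> 'm"

definition is_category :: "('ob, 'm) cat \<Rightarrow> bool" where
  "is_category C \<longleftrightarrow>
     (\<forall>X\<in>Ob C. ide C X \<in> Hom C X X) \<and>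
     (\<forall>X\<in>Ob C. \<forall>Y\<in>Ob C. \<forall>Z\<in>Ob C. \<forall>f\<in>Hom C X Y. \<forall>g\<in>Hom C Y Z.
        cmp C X Y Z g f \<in> Hom C X Z) \<and>
     (\<forall>X\<in>Ob C. \<forall>Y\<in>Ob C. \<forall>f\<in>Hom C X Y.
        cmp C X X Y f (ide C X) = f \<and> cmp C X Y Y (ide C Y) f = f) \<and>
     (\<forall>W\<in>Ob C. \<forall>X\<in>Ob C. \<forall>Y\<in>Ob C. \<forall>Z\<in>Ob C.
        \<forall>f\<in>Hom C W X. \<forall>g\<in>Hom C X Y. \<forall>h\<in>Hom C Y Z.
        cmp C W X Z (cmp C X Y Z h g) f = cmp C W Y Z h (cmp C W X Y g f))"

record ('ob1, 'm1, 'ob2, 'm2) fctr =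
  FOb :: "'ob1 \<Rightarrow> 'ob2"
  FAr :: "'ob1 \<Rightarrow> 'ob1 \<Rightarrow> 'm1 \<Rightarrow> 'm2"

definition is_functor ::
  "('ob1, 'm1) cat \<Rightarrow> ('ob2, 'm2) cat \<Rightarrow> ('ob1, 'm1, 'ob2, 'm2) fctr \<Rightarrow> bool" where
  "is_functor C D F \<longleftrightarrow>
     is_category C \<and> is_category D \<and>
     (\<forall>X\<in>Ob C. FOb F X \<in> Ob D) \<and>
     (\<forall>X\<in>Ob C. \<forall>Y\<in>Ob C. \<forall>f\<in>Hom C X Y. FAr F X Y f \<in> Hom D (FOb F X) (FOb F Y)) \<and>
     (\<forall>X\<in>Ob C. FAr F X X (ide C X) = ide D (FOb F X)) \<and>
     (\<forall>X\<in>Ob C. \<forall>Y\<in>Ob C. \<forall>Z\<in>Ob C. \<forall>f\<in>Hom C X Y. \<forall>g\<in>Hom C Y Z.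
        FAr F X Z (cmp C X Y Z g f) =
        cmp D (FOb F X) (FOb F Y) (FOb F Z) (FAr F Y Z g) (FAr F X Y f))"

definition fcomp ::
  "('ob2, 'm2, 'ob3, 'm3) fctr \<Rightarrow> ('ob1, 'm1, 'ob2, 'm2) fctr \<Rightarrow> ('ob1, 'm1, 'ob3, 'm3) fctr"
  (infixr "\<circ>\<^sub>F" 55) where
  "G \<circ>\<^sub>F F = \<lparr> FOb = (\<lambda>X. FOb G (FOb F X)),
              FAr = (\<lambda>X Y f. FAr G (FOb F X) (FOb F Y) (FAr F X Y f)) \<rparr>"

definition is_natural_transformation ::
  "('ob1, 'm1) cat \<Rightarrow> ('ob2, 'm2) cat \<Rightarrow> ('ob1, 'm1, 'ob2, 'm2) fctr \<Rightarrow>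
   ('ob1, 'm1, 'ob2, 'm2) fctr \<Rightarrow> ('ob1 \<Rightarrow> 'm2) \<Rightarrow> bool" where
  "is_natural_transformation C D F G \<phi> \<longleftrightarrow>
     is_functor C D F \<and> is_functor C D G \<and>
     (\<forall>X\<in>Ob C. \<phi> X \<in> Hom D (FOb F X) (FOb G X)) \<and>
     (\<forall>X\<in>Ob C. \<forall>Y\<in>Ob C. \<forall>f\<in>Hom C X Y.
        cmp D (FOb F X) (FOb F Y) (FOb G Y) (\<phi> Y) (FAr F X Y f) =
        cmp D (FOb F X) (FOb G X) (FOb G Y) (FAr G X Y f) (\<phi> X))"

definition is_iso :: "('ob, 'm) cat \<Rightarrow> 'ob \<Rightarrow> 'ob \<Rightarrow> 'm \<Rightarrow> bool" where
  "is_iso C X Y f \<longleftrightarrow> f \<in> Hom C X Y \<and>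
     (\<exists>g\<in>Hom C Y X. cmp C X Y X g f = ide C X \<and> cmp C Y X Y f g = ide C Y)"

definition is_natural_isomorphism ::
  "('ob1, 'm1) cat \<Rightarrow> ('ob2, 'm2) cat \<Rightarrow> ('ob1, 'm1, 'ob2, 'm2) fctr \<Rightarrow>
   ('ob1, 'm1, 'ob2, 'm2) fctr \<Rightarrow> ('ob1 \<Rightarrow> 'm2) \<Rightarrow> bool" where
  "is_natural_isomorphism C D F G \<phi> \<longleftrightarrow>
     is_natural_transformation C D F G \<phi> \<and>
     (\<forall>X\<in>Ob C. is_iso D (FOb F X) (FOb G X) (\<phi> X))"

text \<open>
  The functors below build new sets from old ones out of pairs, indices, permutations and finite
  sequences.  So that each category lives on one fixed type, the sets of operations (and the sets
  \<open>E\<close> of the diagrams) are arbitrary subsets of the following type, which is closed under these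
  constructions (the sorts need no such care) and contains, through \<open>Atom\<close>, a copy of the arbitrary type \<^typ>\<open>'x\<close>.
  \<open>Prm\<close> holds a permutation, \<open>Fn\<close> a function on \<open>(n]\<close>, the latter extensional in the
  sense of \<^const>\<open>extensional\<close>.  Triples \<open>\<langle>a, h, i\<rangle>\<close> are read as \<open>\<langle>\<langle>a, h\<rangle>, i\<rangle>\<close>.
\<close>

datatype 'x elem =
    Atom 'x
  | Idx nat
  | Prm "nat \<Rightarrow> nat"
  | Fn "nat \<Rightarrow> 'x elem"
  | Pr "'x elem" "'x elem"  ("\<langle>_,/ _\<rangle>")

fun pi2 :: "'x elem \<Rightarrow> nat" where
  "pi2 \<langle>a, Idx i\<rangle> = i"
| "pi2 _ = undefined"

abbreviation Sym :: "nat \<Rightarrow> (nat \<Rightarrow> nat) set" where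
  "Sym n \<equiv> {\<sigma>. \<sigma> permutes {1..n}}"

text \<open>
  Throughout, the maps that make up a morphism are extensional, so that equality of morphisms is
  equality of these maps on the carriers.  \<^const>\<open>Sym\<close> permutations fix \<open>0\<close>.
\<close>

record ('a, 'o) siga =
  ops   :: "'a set"
  arity :: "'a \<Rightarrow> nat"
  bd    :: "'a \<Rightarrow> nat \<Rightarrow> 'o"
  sorts :: "'o set"

type_synonym ('a, 'o) siga_mor = "('a \<Rightarrow> 'a) \<times> ('a \<Rightarrow> nat \<Rightarrow> nat) \<times> ('o \<Rightarrow> 'o)"

definition is_siga :: "('a, 'o) siga \<Rightarrow> bool" where
  "is_siga S \<longleftrightarrow> (\<forall>a\<in>ops S. bd S a \<in> {0..arity S a} \<rightarrow> sorts S)"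

definition is_siga_mor :: "('a, 'o) siga \<Rightarrow> ('a, 'o) siga \<Rightarrow> ('a, 'o) siga_mor \<Rightarrow> bool" where
  "is_siga_mor S T = (\<lambda>(f, \<sigma>, u).
     f \<in> ops S \<rightarrow>\<^sub>E ops T \<and>
     \<sigma> \<in> (\<Pi>\<^sub>E a\<in>ops S. Sym (arity S a)) \<and>
     u \<in> sorts S \<rightarrow>\<^sub>E sorts T \<and>
     (\<forall>a\<in>ops S. arity T (f a) = arity S a \<and>
        (\<forall>i\<in>{0..arity S a}. u (bd S a (\<sigma> a i)) = bd T (f a) i)))"

definition Sig_a :: "(('a, 'o) siga, ('a, 'o) siga_mor) cat" where
  "Sig_a = \<lparr>
     Ob = {S. is_siga S},
     Hom = (\<lambda>S T. {m. is_siga_mor S T m}),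
     cmp = (\<lambda>S T U (g, \<tau>, v) (f, \<sigma>, u).
       (compose (ops S) g f, (\<lambda>a\<in>ops S. \<sigma> a \<circ> \<tau> (f a)), compose (sorts S) v u)),
     ide = (\<lambda>S. (\<lambda>a\<in>ops S. a, \<lambda>a\<in>ops S. id, \<lambda>x\<in>sorts S. x)) \<rparr>"

text \<open>
  \<open>E \<rightarrow> E'\<close> over \<open>A \<rightarrow> A'\<close> is a pullback in the category of sets: the square commutes and the
  comparison map to the fibre product is bijective.
\<close>

definition is_pullback ::
  "'e set \<Rightarrow> 'a set \<Rightarrow> 'e2 set \<Rightarrow> ('e \<Rightarrow> 'a) \<Rightarrow> ('e \<Rightarrow> 'e2) \<Rightarrow> ('a \<Rightarrow> 'b) \<Rightarrow> ('e2 \<Rightarrow> 'b) \<Rightarrow> bool" where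
  "is_pullback E A E' p g f p' \<longleftrightarrow>
     (\<forall>e\<in>E. f (p e) = p' (g e)) \<and>
     bij_betw (\<lambda>e. (p e, g e)) E {(a, e'). a \<in> A \<and> e' \<in> E' \<and> f a = p' e'}"

record ('e, 'a, 'o) pdiag =
  psorts :: "'o set"
  pE :: "'e set"
  pA :: "'a set"
  ps :: "'e \<Rightarrow> 'o"
  pp :: "'e \<Rightarrow> 'a"
  pt :: "'a \<Rightarrow> 'o"

type_synonym ('e, 'a, 'o) diag_mor = "('a \<Rightarrow> 'a) \<times> ('e \<Rightarrow> 'e) \<times> ('o \<Rightarrow> 'o)"

definition pfib :: "('e, 'a, 'o) pdiag \<Rightarrow> 'a \<Rightarrow> 'e set" where
  "pfib P a = {e\<in>pE P. pp P e = a}"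

definition is_pdiag :: "('e, 'a, 'o) pdiag \<Rightarrow> bool" where
  "is_pdiag P \<longleftrightarrow>
     ps P \<in> pE P \<rightarrow> psorts P \<and> pp P \<in> pE P \<rightarrow> pA P \<and> pt P \<in> pA P \<rightarrow> psorts P \<and>
     (\<forall>a\<in>pA P. finite (pfib P a))"

definition is_pdiag_mor ::
  "('e, 'a, 'o) pdiag \<Rightarrow> ('e, 'a, 'o) pdiag \<Rightarrow> ('e, 'a, 'o) diag_mor \<Rightarrow> bool" where
  "is_pdiag_mor P Q = (\<lambda>(f, g, u).
     f \<in> pA P \<rightarrow>\<^sub>E pA Q \<and> g \<in> pE P \<rightarrow>\<^sub>E pE Q \<and> u \<in> psorts P \<rightarrow>\<^sub>E psorts Q \<and>
     (\<forall>e\<in>pE P. ps Q (g e) = u (ps P e)) \<and>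
     (\<forall>a\<in>pA P. pt Q (f a) = u (pt P a)) \<and>
     is_pullback (pE P) (pA P) (pE Q) (pp P) g f (pp Q))"

definition PolyDiag :: "(('e, 'a, 'o) pdiag, ('e, 'a, 'o) diag_mor) cat" where
  "PolyDiag = \<lparr>
     Ob = {P. is_pdiag P},
     Hom = (\<lambda>P Q. {m. is_pdiag_mor P Q m}),
     cmp = (\<lambda>P Q R (f', g', u') (f, g, u).
       (compose (pA P) f' f, compose (pE P) g' g, compose (psorts P) u' u)),
     ide = (\<lambda>P. (\<lambda>a\<in>pA P. a, \<lambda>e\<in>pE P. e, \<lambda>x\<in>psorts P. x)) \<rparr>"

text \<open>
  A symmetric set is represented by the disjoint union of its family, graded by \<open>|a|\<close>; that is,
  \<open>A\<^sub>n\<close> is the set of the \<open>a\<close> in the carrier with grade \<open>n\<close>.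
\<close>

record 'a symset =
  crr :: "'a set"
  grd :: "'a \<Rightarrow> nat"
  act :: "'a \<Rightarrow> (nat \<Rightarrow> nat) \<Rightarrow> 'a"

definition is_symset :: "('a, 'z) symset_scheme \<Rightarrow> bool" where
  "is_symset A \<longleftrightarrow> (\<forall>a\<in>crr A.
     (\<forall>\<sigma>\<in>Sym (grd A a). act A a \<sigma> \<in> crr A \<and> grd A (act A a \<sigma>) = grd A a) \<and>
     act A a id = a \<and>
     (\<forall>\<sigma>\<in>Sym (grd A a). \<forall>\<tau>\<in>Sym (grd A a). act A (act A a \<sigma>) \<tau> = act A a (\<sigma> \<circ> \<tau>)))"

definition is_equivariant ::
  "('a, 'y) symset_scheme \<Rightarrow> ('b, 'z) symset_scheme \<Rightarrow> ('a \<Rightarrow> 'b) \<Rightarrow> bool" where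
  "is_equivariant A B f \<longleftrightarrow> f \<in> crr A \<rightarrow> crr B \<and>
     (\<forall>a\<in>crr A. grd B (f a) = grd A a \<and>
        (\<forall>\<sigma>\<in>Sym (grd A a). f (act A a \<sigma>) = act B (f a) \<sigma>))"

record ('a, 'o) sigs = "'a symset" +
  sbd   :: "'a \<Rightarrow> nat \<Rightarrow> 'o"
  ssorts :: "'o set"

type_synonym ('a, 'o) sigs_mor = "('a \<Rightarrow> 'a) \<times> ('o \<Rightarrow> 'o)"

definition is_sigs :: "('a, 'o) sigs \<Rightarrow> bool" where
  "is_sigs S \<longleftrightarrow> is_symset S \<and>
     (\<forall>a\<in>crr S. sbd S a \<in> {0..grd S a} \<rightarrow> ssorts S \<and>
        (\<forall>\<sigma>\<in>Sym (grd S a). \<forall>i\<in>{0..grd S a}. sbd S (act S a \<sigma>) i = sbd S a (\<sigma> i)))"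

definition is_sigs_mor :: "('a, 'o) sigs \<Rightarrow> ('a, 'o) sigs \<Rightarrow> ('a, 'o) sigs_mor \<Rightarrow> bool" where
  "is_sigs_mor S T = (\<lambda>(f, u).
     f \<in> extensional (crr S) \<and> is_equivariant S T f \<and> u \<in> ssorts S \<rightarrow>\<^sub>E ssorts T \<and>
     (\<forall>a\<in>crr S. \<forall>i\<in>{0..grd S a}. sbd T (f a) i = u (sbd S a i)))"

definition Sig_s :: "(('a, 'o) sigs, ('a, 'o) sigs_mor) cat" where
  "Sig_s = \<lparr>
     Ob = {S. is_sigs S},
     Hom = (\<lambda>S T. {m. is_sigs_mor S T m}),
     cmp = (\<lambda>S T U (g, v) (f, u). (compose (crr S) g f, compose (ssorts S) v u)),
     ide = (\<lambda>S. (\<lambda>a\<in>crr S. a, \<lambda>x\<in>ssorts S. x)) \<rparr>"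

definition delta :: "'o set \<Rightarrow> (nat \<times> 'o) symset" where
  "delta X = \<lparr> crr = UNIV \<times> X, grd = fst, act = (\<lambda>x \<sigma>. x) \<rparr>"

definition delta_map :: "('o \<Rightarrow> 'q) \<Rightarrow> nat \<times> 'o \<Rightarrow> nat \<times> 'q" where
  "delta_map u = (\<lambda>(n, x). (n, u x))"

definition to_delta1 :: "'a symset \<Rightarrow> 'a \<Rightarrow> nat \<times> unit" where
  "to_delta1 A = (\<lambda>a. (grd A a, ()))"

definition RR :: "(nat \<times> nat) symset" where
  "RR = \<lparr> crr = {(n, i). i \<in> {1..n}}, grd = fst, act = (\<lambda>(n, i) \<tau>. (n, inv \<tau> i)) \<rparr>"

record ('e, 'a, 'o) andiag =
  asorts :: "'o set"
  anE :: "'e symset"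
  anA :: "'a symset"
  ans :: "'e \<Rightarrow> nat \<times> 'o"
  anp :: "'e \<Rightarrow> 'a"
  ant :: "'a \<Rightarrow> nat \<times> 'o"
  anr :: "'e \<Rightarrow> nat \<times> nat"

text \<open>
  Pullbacks of symmetric sets are formed degreewise, that is, on underlying graded sets; hence
  \<^const>\<open>is_pullback\<close> applied to the carriers expresses that a square of equivariant maps is a
  pullback of symmetric sets.
\<close>

definition is_andiag :: "('e, 'a, 'o) andiag \<Rightarrow> bool" where
  "is_andiag P \<longleftrightarrow> is_symset (anE P) \<and> is_symset (anA P) \<and>
     is_equivariant (anE P) (delta (asorts P)) (ans P) \<and>
     is_equivariant (anE P) (anA P) (anp P) \<and>
     is_equivariant (anA P) (delta (asorts P)) (ant P) \<and>
     is_equivariant (anE P) RR (anr P) \<and>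
     is_pullback (crr (anE P)) (crr (anA P)) (crr RR) (anp P) (anr P)
       (to_delta1 (anA P)) (to_delta1 RR)"

definition is_andiag_mor ::
  "('e, 'a, 'o) andiag \<Rightarrow> ('e, 'a, 'o) andiag \<Rightarrow> ('e, 'a, 'o) diag_mor \<Rightarrow> bool" where
  "is_andiag_mor P Q = (\<lambda>(f, g, u).
     f \<in> extensional (crr (anA P)) \<and> is_equivariant (anA P) (anA Q) f \<and>
     g \<in> extensional (crr (anE P)) \<and> is_equivariant (anE P) (anE Q) g \<and>
     u \<in> asorts P \<rightarrow>\<^sub>E asorts Q \<and>
     (\<forall>e\<in>crr (anE P). ans Q (g e) = delta_map u (ans P e)) \<and>
     (\<forall>a\<in>crr (anA P). ant Q (f a) = delta_map u (ant P a)) \<and>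
     is_pullback (crr (anE P)) (crr (anA P)) (crr (anE Q)) (anp P) g f (anp Q) \<and>
     (\<forall>e\<in>crr (anE P). anr Q (g e) = anr P e))"

definition AnDiag :: "(('e, 'a, 'o) andiag, ('e, 'a, 'o) diag_mor) cat" where
  "AnDiag = \<lparr>
     Ob = {P. is_andiag P},
     Hom = (\<lambda>P Q. {m. is_andiag_mor P Q m}),
     cmp = (\<lambda>P Q R (f', g', u') (f, g, u).
       (compose (crr (anA P)) f' f, compose (crr (anE P)) g' g, compose (asorts P) u' u)),
     ide = (\<lambda>P. (\<lambda>a\<in>crr (anA P). a, \<lambda>e\<in>crr (anE P). e, \<lambda>x\<in>asorts P. x)) \<rparr>"

text \<open>
  In the \<open>case\<close> expressions below only the listed patterns occur in the carrier concerned; outside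
  of it the value is irrelevant.
\<close>

definition iota_a_ob :: "('x elem, 'o) siga \<Rightarrow> ('x elem, 'x elem, 'o) pdiag" where
  "iota_a_ob S = \<lparr>
     psorts = sorts S,
     pE = {\<langle>a, Idx i\<rangle> | a i. a \<in> ops S \<and> i \<in> {1..arity S a}},
     pA = ops S,
     ps = (\<lambda>e. case e of \<langle>a, Idx i\<rangle> \<Rightarrow> bd S a i),
     pp = (\<lambda>e. case e of \<langle>a, Idx i\<rangle> \<Rightarrow> a),
     pt = (\<lambda>a. bd S a 0) \<rparr>"

definition iota_a ::
  "(('x elem, 'o) siga, ('x elem, 'o) siga_mor,
    ('x elem, 'x elem, 'o) pdiag, ('x elem, 'x elem, 'o) diag_mor) fctr" where
  "iota_a = \<lparr>
     FOb = iota_a_ob,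
     FAr = (\<lambda>S T (f, \<sigma>, u).
       (f, \<lambda>e\<in>pE (iota_a_ob S). case e of \<langle>a, Idx i\<rangle> \<Rightarrow> \<langle>f a, Idx (inv (\<sigma> a) i)\<rangle>, u)) \<rparr>"

definition K_sig_ob :: "('x elem, 'o) siga \<Rightarrow> ('x elem, 'o) sigs" where
  "K_sig_ob S = \<lparr>
     crr = {\<langle>a, Prm \<tau>\<rangle> | a \<tau>. a \<in> ops S \<and> \<tau> \<in> Sym (arity S a)},
     grd = (\<lambda>x. case x of \<langle>a, Prm \<tau>\<rangle> \<Rightarrow> arity S a),
     act = (\<lambda>x \<tau>'. case x of \<langle>a, Prm \<tau>\<rangle> \<Rightarrow> \<langle>a, Prm (\<tau> \<circ> \<tau>')\<rangle>),
     sbd = (\<lambda>x. case x of \<langle>a, Prm \<tau>\<rangle> \<Rightarrow> bd S a \<circ> \<tau>),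
     ssorts = sorts S \<rparr>"

definition K_sig ::
  "(('x elem, 'o) siga, ('x elem, 'o) siga_mor, ('x elem, 'o) sigs, ('x elem, 'o) sigs_mor) fctr"
  where
  "K_sig = \<lparr>
     FOb = K_sig_ob,
     FAr = (\<lambda>S T (f, \<sigma>, u).
       (\<lambda>x\<in>crr (K_sig_ob S). case x of \<langle>a, Prm \<tau>\<rangle> \<Rightarrow> \<langle>f a, Prm (inv (\<sigma> a) \<circ> \<tau>)\<rangle>, u)) \<rparr>"

definition iota_s_ob :: "('x elem, 'o) sigs \<Rightarrow> ('x elem, 'x elem, 'o) andiag" where
  "iota_s_ob S = \<lparr>
     asorts = ssorts S,
     anE = \<lparr> crr = {\<langle>a, Idx i\<rangle> | a i. a \<in> crr S \<and> i \<in> {1..grd S a}},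
            grd = (\<lambda>e. case e of \<langle>a, Idx i\<rangle> \<Rightarrow> grd S a),
            act = (\<lambda>e \<sigma>. case e of \<langle>a, Idx i\<rangle> \<Rightarrow> \<langle>act S a \<sigma>, Idx (inv \<sigma> i)\<rangle>) \<rparr>,
     anA = \<lparr> crr = crr S, grd = grd S, act = act S \<rparr>,
     ans = (\<lambda>e. case e of \<langle>a, Idx i\<rangle> \<Rightarrow> (grd S a, sbd S a i)),
     anp = (\<lambda>e. case e of \<langle>a, Idx i\<rangle> \<Rightarrow> a),
     ant = (\<lambda>a. (grd S a, sbd S a 0)),
     anr = (\<lambda>e. case e of \<langle>a, Idx i\<rangle> \<Rightarrow> (grd S a, i)) \<rparr>"

definition iota_s ::
  "(('x elem, 'o) sigs, ('x elem, 'o) sigs_mor,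
    ('x elem, 'x elem, 'o) andiag, ('x elem, 'x elem, 'o) diag_mor) fctr" where
  "iota_s = \<lparr>
     FOb = iota_s_ob,
     FAr = (\<lambda>S T (f, u).
       (f, \<lambda>e\<in>crr (anE (iota_s_ob S)). case e of \<langle>a, Idx i\<rangle> \<Rightarrow> \<langle>f a, Idx i\<rangle>, u)) \<rparr>"

text \<open>
  A bijection \<open>h\<close> from \<open>(n]\<close> is extensional on \<open>{1..n}\<close>, hence so is \<open>h \<circ> \<tau>\<close> for a permutation
  \<open>\<tau>\<close> of \<open>{1..n}\<close>.
\<close>

definition K_diag_ob :: "('x elem, 'x elem, 'o) pdiag \<Rightarrow> ('x elem, 'x elem, 'o) andiag" where
  "K_diag_ob P = (
     let sz = (\<lambda>a. card (pfib P a));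
         A = {\<langle>a, Fn h\<rangle> | a h. a \<in> pA P \<and>
                h \<in> extensional {1..sz a} \<and> bij_betw h {1..sz a} (pfib P a)}
     in \<lparr>
     asorts = psorts P,
     anE = \<lparr> crr = {\<langle>\<langle>a, Fn h\<rangle>, Idx i\<rangle> | a h i. \<langle>a, Fn h\<rangle> \<in> A \<and> i \<in> {1..sz a}},
            grd = (\<lambda>e. case e of \<langle>\<langle>a, Fn h\<rangle>, Idx i\<rangle> \<Rightarrow> sz a),
            act = (\<lambda>e \<tau>. case e of \<langle>\<langle>a, Fn h\<rangle>, Idx i\<rangle> \<Rightarrow> \<langle>\<langle>a, Fn (h \<circ> \<tau>)\<rangle>, Idx (inv \<tau> i)\<rangle>) \<rparr>,
     anA = \<lparr> crr = A,
            grd = (\<lambda>x. case x of \<langle>a, Fn h\<rangle> \<Rightarrow> sz a),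
            act = (\<lambda>x \<tau>. case x of \<langle>a, Fn h\<rangle> \<Rightarrow> \<langle>a, Fn (h \<circ> \<tau>)\<rangle>) \<rparr>,
     ans = (\<lambda>e. case e of \<langle>\<langle>a, Fn h\<rangle>, Idx i\<rangle> \<Rightarrow> (sz a, ps P (h i))),
     anp = (\<lambda>e. case e of \<langle>\<langle>a, Fn h\<rangle>, Idx i\<rangle> \<Rightarrow> \<langle>a, Fn h\<rangle>),
     ant = (\<lambda>x. case x of \<langle>a, Fn h\<rangle> \<Rightarrow> (sz a, pt P a)),
     anr = (\<lambda>e. case e of \<langle>\<langle>a, Fn h\<rangle>, Idx i\<rangle> \<Rightarrow> (sz a, i)) \<rparr>)"

definition K_diag ::
  "(('x elem, 'x elem, 'o) pdiag, ('x elem, 'x elem, 'o) diag_mor,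
    ('x elem, 'x elem, 'o) andiag, ('x elem, 'x elem, 'o) diag_mor) fctr" where
  "K_diag = \<lparr>
     FOb = K_diag_ob,
     FAr = (\<lambda>P Q (f, g, u).
       (\<lambda>x\<in>crr (anA (K_diag_ob P)). case x of \<langle>a, Fn h\<rangle> \<Rightarrow>
          \<langle>f a, Fn (compose {1..card (pfib P a)} g h)\<rangle>,
        \<lambda>e\<in>crr (anE (K_diag_ob P)). case e of \<langle>\<langle>a, Fn h\<rangle>, Idx i\<rangle> \<Rightarrow>
          \<langle>\<langle>f a, Fn (compose {1..card (pfib P a)} g h)\<rangle>, Idx i\<rangle>,
        u)) \<rparr>"

text \<open>
  \<open>\<pi>\<^sub>2 \<circ> h\<close> as an element of \<open>S\<^sub>n\<close>: permutations of \<open>(n]\<close> are functions on all of \<^typ>\<open>nat\<close>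
  that fix the numbers outside \<open>(n]\<close>.
\<close>

definition pi2_comp :: "nat \<Rightarrow> (nat \<Rightarrow> 'x elem) \<Rightarrow> nat \<Rightarrow> nat" where
  "pi2_comp n h = (\<lambda>i. if i \<in> {1..n} then pi2 (h i) else i)"

definition Phi :: "('x elem, 'o) siga \<Rightarrow> ('x elem, 'x elem, 'o) diag_mor" where
  "Phi S = (let P = FOb (K_diag \<circ>\<^sub>F iota_a) S in
     (\<lambda>x\<in>crr (anA P). case x of \<langle>a, Fn h\<rangle> \<Rightarrow> \<langle>a, Prm (pi2_comp (arity S a) h)\<rangle>,
      \<lambda>e\<in>crr (anE P). case e of \<langle>\<langle>a, Fn h\<rangle>, Idx i\<rangle> \<Rightarrow>
        \<langle>\<langle>a, Prm (pi2_comp (arity S a) h)\<rangle>, Idx i\<rangle>,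
      \<lambda>x\<in>sorts S. x))"

end

theory Submission
  imports Defs
begin

text \<open>
  A bijection \<open>h\<close> from \<open>(|a|]\<close> onto the fibre \<open>{\<langle>a, i\<rangle>}\<close> of \<open>p\<^sup>A\<close> over \<open>a\<close> is the same thing as the
  permutation \<open>\<pi>\<^sub>2 \<circ> h\<close>, so \<open>\<Phi>\<^sub>0\<close> is bijective.  In a morphism of analytic diagrams \<open>E\<close> is a pullback
  of \<open>E'\<close> along \<open>A \<rightarrow> A'\<close>, so bijectivity on operations and sorts already makes it an isomorphism.
  Naturality is the identity \<open>\<pi>\<^sub>2 \<circ> g \<circ> h = \<sigma>\<^sub>a\<^sup>-\<^sup>1 \<circ> (\<pi>\<^sub>2 \<circ> h)\<close> for \<open>g \<langle>a, i\<rangle> = \<langle>f a, \<sigma>\<^sub>a\<^sup>-\<^sup>1 i\<rangle>\<close>.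
\<close>

text \<open>The claim contains the functoriality of both composites, so the two intermediate
  categories and all four functors have to be verified as well. Much of the shape of the proof comes
  from default values. Morphisms are compared as functions, so each component is cut off to its
  carrier. An enumeration \<open>h\<close> is \<open>undefined\<close> outside (n], whereas a
  permutation is the identity there; \<open>pi2_comp\<close> passes from one convention to the
  other. The inverse of \<sigma> in naturality originates in the law for boundaries, by which input
  \<open>i\<close> of \<open>a\<close> becomes input \<open>inv (\<sigma> a) i\<close> of
  \<open>f a\<close>. The last index of an element of the analytic diagrams is a position in an
  enumeration, not an input: \<open>K_diag\<close>, \<open>iota_s\<close> and \<open>Phi\<close>
  leave it alone on morphisms and only change what stands at that position. Hence naturality on E
  repeats naturality on operations.\<close>

lemma is_functor_fcomp:
  assumes "is_functor C D F" "is_functor D E G"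
  shows "is_functor C E (G \<circ>\<^sub>F F)"
  using assms unfolding is_functor_def fcomp_def by (simp; metis)

subsection \<open>Pullback squares\<close>

lemma is_pullbackI:
  assumes "\<And>e. e \<in> E \<Longrightarrow> p e \<in> A" "\<And>e. e \<in> E \<Longrightarrow> g e \<in> E'"
    and "\<And>e. e \<in> E \<Longrightarrow> f (p e) = p' (g e)"
    and "\<And>d e. \<lbrakk>d \<in> E; e \<in> E; p d = p e; g d = g e\<rbrakk> \<Longrightarrow> d = e"
    and "\<And>a e'. \<lbrakk>a \<in> A; e' \<in> E'; f a = p' e'\<rbrakk> \<Longrightarrow> \<exists>e\<in>E. p e = a \<and> g e = e'"
  shows "is_pullback E A E' p g f p'"
proof -
  have "inj_on (\<lambda>e. (p e, g e)) E"
    using assms(4) by (auto intro!: inj_onI)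
  moreover have "(\<lambda>e. (p e, g e)) ` E = {(a, e'). a \<in> A \<and> e' \<in> E' \<and> f a = p' e'}"
    using assms(1,2,3) by (auto dest!: assms(5))
  ultimately show ?thesis
    unfolding is_pullback_def bij_betw_def using assms(3) by blast
qed

lemma is_pullback_commutes:
  "is_pullback E A E' p g f p' \<Longrightarrow> e \<in> E \<Longrightarrow> f (p e) = p' (g e)"
  unfolding is_pullback_def by blast

lemma is_pullback_eqI:
  "\<lbrakk>is_pullback E A E' p g f p'; d \<in> E; e \<in> E; p d = p e; g d = g e\<rbrakk> \<Longrightarrow> d = e"
  unfolding is_pullback_def bij_betw_def inj_on_def by blast

lemma is_pullback_lift:
  assumes "is_pullback E A E' p g f p'" "a \<in> A" "e' \<in> E'" "f a = p' e'"
  obtains e where "e \<in> E" "p e = a" "g e = e'"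
proof -
  have "(a, e') \<in> (\<lambda>e. (p e, g e)) ` E"
    using assms unfolding is_pullback_def bij_betw_def by blast
  then show ?thesis
    using that by blast
qed

lemma is_pullback_memD:
  assumes "is_pullback E A E' p g f p'" "e \<in> E"
  shows "p e \<in> A" "g e \<in> E'"
  using assms bij_betwE unfolding is_pullback_def by fastforce+

text \<open>A lift through the composite is built in two stages, first through \<open>Q\<close> over
  \<open>f a\<close>, then through \<open>P\<close> over \<open>a\<close>;
  \<open>f \<in> A \<rightarrow> A'\<close> puts \<open>f a\<close> where \<open>Q\<close>
  applies.\<close>

lemma is_pullback_paste:
  assumes P: "is_pullback E A E' p g f p'" and Q: "is_pullback E' A' E'' p' g' f' p''"
    and f: "f \<in> A \<rightarrow> A'"
  shows "is_pullback E A E'' p (compose E g' g) (compose A f' f) p''"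
proof (rule is_pullbackI)
  fix e assume e: "e \<in> E"
  show "p e \<in> A" "compose E g' g e \<in> E''"
    using e is_pullback_memD[OF P] is_pullback_memD[OF Q] by (auto simp: compose_eq)
  show "compose A f' f (p e) = p'' (compose E g' g e)"
    using e is_pullback_memD[OF P e] is_pullback_commutes[OF P e] is_pullback_commutes[OF Q]
    by (auto simp: compose_eq)
next
  fix d e assume "d \<in> E" "e \<in> E" "p d = p e" "compose E g' g d = compose E g' g e"
  \<comment> \<open>Commutativity of \<open>P\<close> gives \<open>p' (g d) = p' (g e)\<close>, so
    \<open>Q\<close> yields \<open>g d = g e\<close>, and then \<open>P\<close> yields the
    claim.\<close>
  then show "d = e"
    using is_pullback_memD[OF P] is_pullback_commutes[OF P]
    by (metis compose_eq is_pullback_eqI[OF P] is_pullback_eqI[OF Q])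
next
  fix a e'' assume a: "a \<in> A" "e'' \<in> E''" "compose A f' f a = p'' e''"
  then obtain e' where e': "e' \<in> E'" "p' e' = f a" "g' e' = e''"
    using is_pullback_lift[OF Q, of "f a" e''] f by (auto simp: compose_eq)
  with a obtain e where "e \<in> E" "p e = a" "g e = e'"
    using is_pullback_lift[OF P, of a e'] by auto
  then show "\<exists>e\<in>E. p e = a \<and> compose E g' g e = e''"
    using e' by (auto simp: compose_eq)
qed

subsection \<open>The categories\<close>

lemma Sym_range: "\<sigma> \<in> Sym n \<Longrightarrow> \<sigma> i \<in> {1..n} \<longleftrightarrow> i \<in> {1..n}"
  using permutes_in_image[of \<sigma> "{1..n}" i] by blast

text \<open>Boundary functions live on [n], with the output at 0. A permutation of (n] fixes 0 and
  so preserves this larger range too.\<close>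

lemma Sym_range0: "\<sigma> \<in> Sym n \<Longrightarrow> \<sigma> i \<in> {0..n} \<longleftrightarrow> i \<in> {0..n}"
  using Sym_range[of \<sigma> n i] permutes_not_in[of \<sigma> "{1..n}" 0]
  by (cases "i = 0"; cases "\<sigma> i = 0") (auto simp: permutes_def)

lemma Sym_inv: "\<sigma> \<in> Sym n \<Longrightarrow> inv \<sigma> \<in> Sym n"
  by (simp add: permutes_inv)

lemma Sym_comp: "\<sigma> \<in> Sym n \<Longrightarrow> \<tau> \<in> Sym n \<Longrightarrow> \<sigma> \<circ> \<tau> \<in> Sym n"
  by (simp add: permutes_compose)

lemma Sym_inv_comp:
  "\<sigma> \<in> Sym n \<Longrightarrow> \<tau> \<in> Sym m \<Longrightarrow> inv (\<sigma> \<circ> \<tau>) = inv \<tau> \<circ> inv \<sigma>"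
  by (simp add: o_inv_distrib permutes_bij)

text \<open>A point outside (n] is fixed by \<tau>, so the default value of \<open>h\<close> there
  survives; the right action therefore stays among extensional enumerations.\<close>

lemma extensional_comp_Sym:
  "h \<in> extensional {1..n} \<Longrightarrow> \<tau> \<in> Sym n \<Longrightarrow> h \<circ> \<tau> \<in> extensional {1..n}"
  using permutes_not_in[of \<tau> "{1..n}"] by (auto simp: extensional_def)

lemma bij_betw_comp_Sym:
  "bij_betw h {1..n} B \<Longrightarrow> \<tau> \<in> Sym n \<Longrightarrow> bij_betw (h \<circ> \<tau>) {1..n} B"
  using bij_betw_trans permutes_imp_bij by blast

text \<open>Associativity of composition, with the cutoff respected because \<tau> preserves (n] and
  its complement. It is the source of the equivariance of \<open>K_diag\<close> on
  morphisms.\<close>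

lemma compose_comp_Sym:
  assumes "\<tau> \<in> Sym n"
  shows "compose {1..n} g (h \<circ> \<tau>) = compose {1..n} g h \<circ> \<tau>"
  using Sym_range[OF assms] by (auto simp: compose_def restrict_def fun_eq_iff)

lemma is_category_Sig_a: "is_category (Sig_a :: (('a, 'o) siga, ('a, 'o) siga_mor) cat)"
proof -
  have comp: "is_siga_mor S U
      (compose (ops S) g f, \<lambda>a\<in>ops S. \<sigma> a \<circ> \<tau> (f a), compose (sorts S) v u)"
    if m: "is_siga_mor S T (f, \<sigma>, u)" and m': "is_siga_mor T U (g, \<tau>, v)"
      and S: "is_siga S" for S T U :: "('a, 'o) siga" and f \<sigma> u g \<tau> v
  proof -
    have f: "f a \<in> ops T" and \<sigma>: "\<sigma> a \<in> Sym (arity S a)"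
        and f_arity: "arity T (f a) = arity S a" if "a \<in> ops S" for a
      using m that unfolding is_siga_mor_def by (auto simp: PiE_iff)
    have \<tau>: "\<tau> (f a) \<in> Sym (arity S a)" and g: "g (f a) \<in> ops U"
        and g_arity: "arity U (g (f a)) = arity S a" if "a \<in> ops S" for a
      using m' f[OF that] f_arity[OF that] unfolding is_siga_mor_def by (auto simp: PiE_iff)
    have u: "u x \<in> sorts T" if "x \<in> sorts S" for x
      using m that unfolding is_siga_mor_def by (auto simp: PiE_iff)
    have v: "v x \<in> sorts U" if "x \<in> sorts T" for x
      using m' that unfolding is_siga_mor_def by (auto simp: PiE_iff)
    have "compose (sorts S) v u (bd S a ((\<sigma> a \<circ> \<tau> (f a)) i)) = bd U (g (f a)) i"
      if a: "a \<in> ops S" and i: "i \<in> {0..arity S a}" for a i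
    proof -
      \<comment> \<open>The two boundary laws are applied at index \<open>\<tau> (f a) i\<close> and
        then at \<open>i\<close>, which is why the composite permutation is
        \<open>\<sigma> a \<circ> \<tau> (f a)\<close>. Indices have to stay in [|a|], where the
        laws hold, and boundary values in \<open>sorts S\<close>, where
        \<open>compose (sorts S) v u\<close> is \<open>v \<circ> u\<close>.\<close>
      have i': "\<tau> (f a) i \<in> {0..arity S a}"
        using Sym_range0[OF \<tau>[OF a]] i by blast
      then have "\<sigma> a (\<tau> (f a) i) \<in> {0..arity S a}"
        using Sym_range0[OF \<sigma>[OF a]] by blast
      then have "bd S a (\<sigma> a (\<tau> (f a) i)) \<in> sorts S"
        using S a unfolding is_siga_def by blast
      then show ?thesis
        using m m' a i i' f[OF a] f_arity[OF a] unfolding is_siga_mor_def by (simp add: compose_eq)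
    qed
    then show ?thesis
      using f g f_arity g_arity u v Sym_comp[OF \<sigma> \<tau>] unfolding is_siga_mor_def
      by (simp add: PiE_iff compose_eq)
  qed
  show ?thesis
    unfolding is_category_def
  proof (intro conjI ballI)
    fix S :: "('a, 'o) siga" assume "S \<in> Ob Sig_a"
    then show "ide Sig_a S \<in> Hom Sig_a S S"
      by (auto simp: Sig_a_def is_siga_mor_def is_siga_def permutes_id Pi_iff)
  next
    fix S T U :: "('a, 'o) siga" and x y
    assume "S \<in> Ob Sig_a" "x \<in> Hom Sig_a S T" "y \<in> Hom Sig_a T U"
    then show "cmp Sig_a S T U y x \<in> Hom Sig_a S U"
      using comp by (cases x; cases y) (auto simp: Sig_a_def)
  next
    fix S T :: "('a, 'o) siga" and x
    assume "x \<in> Hom Sig_a S T"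
    then show "cmp Sig_a S S T x (ide Sig_a S) = x" "cmp Sig_a S T T (ide Sig_a T) x = x"
      by (auto simp: Sig_a_def is_siga_mor_def fun_eq_iff compose_def restrict_def PiE_iff
          extensional_def)
  next
    fix S T U V :: "('a, 'o) siga" and x y z
    assume "x \<in> Hom Sig_a S T" "y \<in> Hom Sig_a T U" "z \<in> Hom Sig_a U V"
    then show "cmp Sig_a S T V (cmp Sig_a T U V z y) x = cmp Sig_a S U V z (cmp Sig_a S T U y x)"
      by (auto simp: Sig_a_def is_siga_mor_def fun_eq_iff compose_def restrict_def PiE_iff)
  qed
qed

lemma is_category_PolyDiag:
  "is_category (PolyDiag :: (('e, 'a, 'o) pdiag, ('e, 'a, 'o) diag_mor) cat)"
  unfolding is_category_def
proof (intro conjI ballI)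
  fix P :: "('e, 'a, 'o) pdiag" assume "P \<in> Ob PolyDiag"
  then show "ide PolyDiag P \<in> Hom PolyDiag P P"
    by (auto simp: PolyDiag_def is_pdiag_mor_def is_pdiag_def Pi_iff intro!: is_pullbackI)
next
  fix P Q R :: "('e, 'a, 'o) pdiag" and x y
  assume "P \<in> Ob PolyDiag" "x \<in> Hom PolyDiag P Q" "y \<in> Hom PolyDiag Q R"
  then show "cmp PolyDiag P Q R y x \<in> Hom PolyDiag P R"
    by (cases x; cases y)
      (auto simp: PolyDiag_def is_pdiag_def is_pdiag_mor_def Pi_iff PiE_iff compose_eq
        intro!: is_pullback_paste)
next
  fix P Q :: "('e, 'a, 'o) pdiag" and x
  assume "x \<in> Hom PolyDiag P Q"
  then show "cmp PolyDiag P P Q x (ide PolyDiag P) = x"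
      "cmp PolyDiag P Q Q (ide PolyDiag Q) x = x"
    by (auto simp: PolyDiag_def is_pdiag_mor_def fun_eq_iff compose_def restrict_def PiE_iff
        extensional_def)
next
  fix P Q R S :: "('e, 'a, 'o) pdiag" and x y z
  assume "x \<in> Hom PolyDiag P Q" "y \<in> Hom PolyDiag Q R" "z \<in> Hom PolyDiag R S"
  then show "cmp PolyDiag P Q S (cmp PolyDiag Q R S z y) x
      = cmp PolyDiag P R S z (cmp PolyDiag P Q R y x)"
    by (auto simp: PolyDiag_def is_pdiag_mor_def fun_eq_iff compose_def restrict_def PiE_iff)
qed

section \<open>Symmetric sets, symmetric signatures and analytic diagrams\<close>

lemma is_symsetD:
  assumes "is_symset A" "a \<in> crr A"
  shows "\<sigma> \<in> Sym (grd A a) \<Longrightarrow> act A a \<sigma> \<in> crr A"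
    and "\<sigma> \<in> Sym (grd A a) \<Longrightarrow> grd A (act A a \<sigma>) = grd A a"
  using assms by (simp_all add: is_symset_def)

lemma is_equivariantD:
  assumes "is_equivariant A B f" "a \<in> crr A"
  shows "f a \<in> crr B" "grd B (f a) = grd A a"
    and "\<sigma> \<in> Sym (grd A a) \<Longrightarrow> f (act A a \<sigma>) = act B (f a) \<sigma>"
  using assms by (auto simp: is_equivariant_def)

lemma is_equivariant_compose:
  assumes "is_symset A" "is_equivariant A B f" "is_equivariant B C g"
  shows "is_equivariant A C (compose (crr A) g f)"
  using assms unfolding is_equivariant_def is_symset_def by (auto simp: compose_eq Pi_iff)

lemma is_equivariant_restrict_id:
  "is_symset A \<Longrightarrow> is_equivariant A A (\<lambda>a\<in>crr A. a)"
  unfolding is_equivariant_def is_symset_def by auto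

lemma is_category_Sig_s: "is_category (Sig_s :: (('a, 'o) sigs, ('a, 'o) sigs_mor) cat)"
  unfolding is_category_def
proof (intro conjI ballI)
  fix S :: "('a, 'o) sigs" assume "S \<in> Ob Sig_s"
  then show "ide Sig_s S \<in> Hom Sig_s S S"
    by (auto simp: Sig_s_def is_sigs_mor_def is_sigs_def Pi_iff is_equivariant_restrict_id)
next
  fix S T U :: "('a, 'o) sigs" and x y
  assume S: "S \<in> Ob Sig_s" and x: "x \<in> Hom Sig_s S T" and y: "y \<in> Hom Sig_s T U"
  obtain f u g v where xy: "x = (f, u)" "y = (g, v)" by (cases x; cases y)
  have e: "is_equivariant S T f" "is_equivariant T U g"
    using x y xy by (auto simp: Sig_s_def is_sigs_mor_def)
  have "is_symset S"
    using S by (auto simp: Sig_s_def is_sigs_def)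
  from is_equivariant_compose[OF this e]
  have "is_equivariant S U (compose (crr S) g f)" .
  moreover have "f a \<in> crr T" "grd T (f a) = grd S a" if "a \<in> crr S" for a
    using e that by (auto simp: is_equivariant_def)
  ultimately show "cmp Sig_s S T U y x \<in> Hom Sig_s S U"
    using S x y by (simp add: xy Sig_s_def is_sigs_def is_sigs_mor_def Pi_iff PiE_iff compose_eq)
next
  fix S T :: "('a, 'o) sigs" and x
  assume "x \<in> Hom Sig_s S T"
  then show "cmp Sig_s S S T x (ide Sig_s S) = x" "cmp Sig_s S T T (ide Sig_s T) x = x"
    by (auto simp: Sig_s_def is_sigs_mor_def is_equivariant_def fun_eq_iff compose_def
        restrict_def PiE_iff Pi_iff extensional_def)
next
  fix S T U V :: "('a, 'o) sigs" and x y z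
  assume "x \<in> Hom Sig_s S T" "y \<in> Hom Sig_s T U" "z \<in> Hom Sig_s U V"
  then show "cmp Sig_s S T V (cmp Sig_s T U V z y) x = cmp Sig_s S U V z (cmp Sig_s S T U y x)"
    by (auto simp: Sig_s_def is_sigs_mor_def is_equivariant_def fun_eq_iff compose_def
        restrict_def PiE_iff Pi_iff)
qed

text \<open>
  The pullback condition on morphisms is automatic: both \<open>E\<close> and \<open>E'\<close> are pullbacks of \<open>R\<close>.
\<close>

lemma is_andiag_mor_iff:
  assumes P: "is_andiag P" and Q: "is_andiag Q"
  shows "is_andiag_mor P Q (f, g, u) \<longleftrightarrow>
     f \<in> extensional (crr (anA P)) \<and> is_equivariant (anA P) (anA Q) f \<and>
     g \<in> extensional (crr (anE P)) \<and> is_equivariant (anE P) (anE Q) g \<and>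
     u \<in> asorts P \<rightarrow>\<^sub>E asorts Q \<and>
     (\<forall>e\<in>crr (anE P). ans Q (g e) = delta_map u (ans P e)) \<and>
     (\<forall>a\<in>crr (anA P). ant Q (f a) = delta_map u (ant P a)) \<and>
     (\<forall>e\<in>crr (anE P). f (anp P e) = anp Q (g e)) \<and>
     (\<forall>e\<in>crr (anE P). anr Q (g e) = anr P e)"
    (is "_ \<longleftrightarrow> ?R")
proof
  assume ?R
  have pbP: "is_pullback (crr (anE P)) (crr (anA P)) (crr RR) (anp P) (anr P)
       (to_delta1 (anA P)) (to_delta1 RR)"
    using P unfolding is_andiag_def by blast
  have pbQ: "is_pullback (crr (anE Q)) (crr (anA Q)) (crr RR) (anp Q) (anr Q)
       (to_delta1 (anA Q)) (to_delta1 RR)"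
    using Q unfolding is_andiag_def by blast
  have "is_pullback (crr (anE P)) (crr (anA P)) (crr (anE Q)) (anp P) g f (anp Q)"
  proof (rule is_pullbackI)
    fix e assume "e \<in> crr (anE P)"
    then show "anp P e \<in> crr (anA P)" "g e \<in> crr (anE Q)" "f (anp P e) = anp Q (g e)"
      using \<open>?R\<close> is_pullback_memD[OF pbP] by (auto simp: is_equivariant_def)
  next
    fix d e assume "d \<in> crr (anE P)" "e \<in> crr (anE P)" "anp P d = anp P e" "g d = g e"
    then show "d = e"
      using \<open>?R\<close> by (metis is_pullback_eqI[OF pbP])
  next
    fix a e' assume a: "a \<in> crr (anA P)" "e' \<in> crr (anE Q)" "f a = anp Q e'"
    have "grd (anA P) a = grd (anA Q) (f a)"
      using \<open>?R\<close> a(1) by (simp add: is_equivariant_def)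
    \<comment> \<open>Since \<open>f\<close> preserves grades, \<open>a\<close> and
      \<open>anr Q e'\<close> match over \<delta>(1). The \<open>e\<close> that they determine in
      \<open>P\<close> satisfies \<open>g e = e'\<close>, because both sides have the same operation
      and the same index in \<open>Q\<close>.\<close>
    then have "to_delta1 (anA P) a = to_delta1 RR (anr Q e')"
      using is_pullback_commutes[OF pbQ a(2)] a(3) by (simp add: to_delta1_def)
    then obtain e where e: "e \<in> crr (anE P)" "anp P e = a" "anr P e = anr Q e'"
      using is_pullback_lift[OF pbP a(1)] is_pullback_memD[OF pbQ a(2)] by metis
    have "g e = e'"
      by (rule is_pullback_eqI[OF pbQ]) (use \<open>?R\<close> a e in \<open>auto simp: is_equivariant_def\<close>)
    with e show "\<exists>e\<in>crr (anE P). anp P e = a \<and> g e = e'"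
      by blast
  qed
  with \<open>?R\<close> show "is_andiag_mor P Q (f, g, u)"
    unfolding is_andiag_mor_def by simp
qed (auto simp: is_andiag_mor_def dest: is_pullback_commutes)

lemma delta_map_comp: "delta_map v (delta_map u x) = delta_map (\<lambda>y. v (u y)) x"
  by (simp add: delta_map_def split: prod.split)

lemma delta_map_cong:
  "x \<in> crr (delta X) \<Longrightarrow> (\<And>y. y \<in> X \<Longrightarrow> u y = v y) \<Longrightarrow> delta_map u x = delta_map v x"
  by (auto simp: delta_map_def delta_def)

lemma is_category_AnDiag:
  "is_category (AnDiag :: (('e, 'a, 'o) andiag, ('e, 'a, 'o) diag_mor) cat)"
  unfolding is_category_def
proof (intro conjI ballI)
  fix P :: "('e, 'a, 'o) andiag" assume "P \<in> Ob AnDiag"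
  then have P: "is_andiag P"
    by (simp add: AnDiag_def)
  have idd: "delta_map (\<lambda>x\<in>asorts P. x) z = z" if "z \<in> crr (delta (asorts P))" for z
    using that by (auto simp: delta_map_def delta_def)
  have "ans P e \<in> crr (delta (asorts P))" "anp P e \<in> crr (anA P)" if "e \<in> crr (anE P)" for e
    using that P by (auto simp: is_andiag_def is_equivariant_def)
  moreover have "ant P a \<in> crr (delta (asorts P))" if "a \<in> crr (anA P)" for a
    using that P by (auto simp: is_andiag_def is_equivariant_def)
  moreover have "is_symset (anE P)" "is_symset (anA P)"
    using P by (simp_all add: is_andiag_def)
  ultimately show "ide AnDiag P \<in> Hom AnDiag P P"
    using P by (simp add: AnDiag_def is_andiag_mor_iff is_equivariant_restrict_id idd)
next
  fix P Q R :: "('e, 'a, 'o) andiag" and x y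
  assume "P \<in> Ob AnDiag" "Q \<in> Ob AnDiag" "R \<in> Ob AnDiag"
    and x: "x \<in> Hom AnDiag P Q" and y: "y \<in> Hom AnDiag Q R"
  then have P: "is_andiag P" and Q: "is_andiag Q" and R: "is_andiag R"
    by (simp_all add: AnDiag_def)
  obtain f g u f' g' u' where xy: "x = (f, g, u)" "y = (f', g', u')" by (cases x; cases y)
  have m: "is_andiag_mor P Q (f, g, u)" and m': "is_andiag_mor Q R (f', g', u')"
    using x y xy by (auto simp: AnDiag_def)
  have mem: "g e \<in> crr (anE Q)" "anp P e \<in> crr (anA P)" "ans P e \<in> crr (delta (asorts P))"
    if "e \<in> crr (anE P)" for e
    using that m P by (auto simp: is_andiag_mor_def is_andiag_def is_equivariant_def)
  have mem': "f a \<in> crr (anA Q)" "ant P a \<in> crr (delta (asorts P))"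
    if "a \<in> crr (anA P)" for a
    using that m P by (auto simp: is_andiag_mor_def is_andiag_def is_equivariant_def)
  \<comment> \<open>Chaining the two sort conditions produces the plain composite of
    \<open>u'\<close> and \<open>u\<close>; the morphism contains the one cut off to
    \<open>asorts P\<close>. They agree on all sorts that occur.\<close>
  have uu: "delta_map (\<lambda>y. u' (u y)) z = delta_map (compose (asorts P) u' u) z"
    if "z \<in> crr (delta (asorts P))" for z
    by (rule delta_map_cong[OF that]) (simp add: compose_eq)
  have "compose (asorts P) u' u \<in> asorts P \<rightarrow>\<^sub>E asorts R"
    using m m' by (auto simp: is_andiag_mor_def PiE_iff compose_eq)
  then have "is_andiag_mor P R
      (compose (crr (anA P)) f' f, compose (crr (anE P)) g' g, compose (asorts P) u' u)"
    using m m' P mem mem' uu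
    unfolding is_andiag_mor_iff[OF P Q] is_andiag_mor_iff[OF Q R] is_andiag_mor_iff[OF P R]
    by (auto simp: is_andiag_def compose_eq delta_map_comp intro: is_equivariant_compose)
  then show "cmp AnDiag P Q R y x \<in> Hom AnDiag P R"
    by (simp add: xy AnDiag_def)
next
  fix P Q :: "('e, 'a, 'o) andiag" and x
  assume "x \<in> Hom AnDiag P Q"
  then show "cmp AnDiag P P Q x (ide AnDiag P) = x"
      "cmp AnDiag P Q Q (ide AnDiag Q) x = x"
    by (auto simp: AnDiag_def is_andiag_mor_def is_equivariant_def fun_eq_iff compose_def
        restrict_def PiE_iff Pi_iff extensional_def)
next
  fix P Q R S :: "('e, 'a, 'o) andiag" and x y z
  assume "x \<in> Hom AnDiag P Q" "y \<in> Hom AnDiag Q R" "z \<in> Hom AnDiag R S"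
  then show "cmp AnDiag P Q S (cmp AnDiag Q R S z y) x
      = cmp AnDiag P R S z (cmp AnDiag P Q R y x)"
    by (auto simp: AnDiag_def is_andiag_mor_def is_equivariant_def fun_eq_iff compose_def
        restrict_def PiE_iff Pi_iff)
qed

subsection \<open>Isomorphisms of analytic diagrams\<close>

lemma is_andiag_morD:
  assumes "is_andiag_mor P Q (f, g, u)"
  shows "is_equivariant (anA P) (anA Q) f" "is_equivariant (anE P) (anE Q) g"
    and "\<And>e. e \<in> crr (anE P) \<Longrightarrow> f (anp P e) = anp Q (g e)"
  using assms unfolding is_andiag_mor_def by (auto dest: is_pullback_commutes)

text \<open>Every \<open>b\<close> is some \<open>f a\<close>, so the claim at \<open>b\<close> is
  equivariance of \<open>f\<close> at \<open>a\<close> read backwards. The cutoff to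
  \<open>crr B\<close> makes the inverse extensional, as components of morphisms must be.\<close>

lemma is_equivariant_inv_into:
  assumes A: "is_symset A" and B: "is_symset B"
    and f: "is_equivariant A B f" and bij: "bij_betw f (crr A) (crr B)"
  shows "is_equivariant B A (\<lambda>b\<in>crr B. inv_into (crr A) f b)"
proof -
  have "grd A a = grd B (f a)"
    and "inv_into (crr A) f (act B (f a) \<sigma>) = act A a \<sigma>"
    if "a \<in> crr A" "\<sigma> \<in> Sym (grd B (f a))" for a \<sigma>
  proof -
    show g: "grd A a = grd B (f a)"
      using is_equivariantD(2)[OF f that(1)] by simp
    have "act B (f a) \<sigma> = f (act A a \<sigma>)" "act A a \<sigma> \<in> crr A"
      using is_equivariantD(3)[OF f that(1)] is_symsetD(1)[OF A that(1)] that(2) g by simp_all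
    then show "inv_into (crr A) f (act B (f a) \<sigma>) = act A a \<sigma>"
      using bij by (simp add: bij_betw_def)
  qed
  note fa = this
  have "grd A (inv_into (crr A) f b) = grd B b"
    and "inv_into (crr A) f (act B b \<sigma>) = act A (inv_into (crr A) f b) \<sigma>"
    if b: "b \<in> crr B" "\<sigma> \<in> Sym (grd B b)" for b \<sigma>
  proof -
    obtain a where a: "a \<in> crr A" "b = f a"
      using b(1) bij by (auto simp: bij_betw_def)
    then have "inv_into (crr A) f b = a"
      using bij by (simp add: bij_betw_def)
    then show "grd A (inv_into (crr A) f b) = grd B b"
      and "inv_into (crr A) f (act B b \<sigma>) = act A (inv_into (crr A) f b) \<sigma>"
      using fa[OF a(1)] a(2) b(2) by simp_all
  qed
  note fb = this
  show ?thesis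
    unfolding is_equivariant_def
  proof (intro conjI ballI)
    show "(\<lambda>b\<in>crr B. inv_into (crr A) f b) \<in> crr B \<rightarrow> crr A"
      using bij by (auto simp: bij_betw_def intro: inv_into_into)
  next
    fix b assume b: "b \<in> crr B"
    \<comment> \<open>The fact on grades was obtained together with the one on actions and carries a
      permutation as premise; the identity serves.\<close>
    then show "grd A ((\<lambda>b\<in>crr B. inv_into (crr A) f b) b) = grd B b"
      using fb(1)[OF b, of id] by (simp add: permutes_id)
    fix \<sigma> assume "\<sigma> \<in> Sym (grd B b)"
    then show "(\<lambda>b\<in>crr B. inv_into (crr A) f b) (act B b \<sigma>)
        = act A ((\<lambda>b\<in>crr B. inv_into (crr A) f b) b) \<sigma>"
      using fb(2)[OF b] b B by (simp add: is_symset_def)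
  qed
qed

lemma is_iso_AnDiagI:
  assumes P: "is_andiag P" and Q: "is_andiag Q" and m: "is_andiag_mor P Q (f, g, u)"
    and bf: "bij_betw f (crr (anA P)) (crr (anA Q))" and bu: "bij_betw u (asorts P) (asorts Q)"
  shows "is_iso AnDiag P Q (f, g, u)"
proof -
  have pb: "is_pullback (crr (anE P)) (crr (anA P)) (crr (anE Q)) (anp P) g f (anp Q)"
    using m by (simp add: is_andiag_mor_def)
  have bg: "bij_betw g (crr (anE P)) (crr (anE Q))"
    unfolding bij_betw_def
  proof
    show "inj_on g (crr (anE P))"
    proof (rule inj_onI)
      fix d e assume de: "d \<in> crr (anE P)" "e \<in> crr (anE P)" "g d = g e"
      then have "f (anp P d) = f (anp P e)"
        using is_pullback_commutes[OF pb] by simp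
      then have "anp P d = anp P e"
        using de is_pullback_memD[OF pb] bf by (meson bij_betw_def inj_onD)
      with de show "d = e"
        by (auto intro: is_pullback_eqI[OF pb])
    qed
    show "g ` crr (anE P) = crr (anE Q)"
    proof
      show "g ` crr (anE P) \<subseteq> crr (anE Q)"
        using is_pullback_memD[OF pb] by blast
    next
      show "crr (anE Q) \<subseteq> g ` crr (anE P)"
      proof
        fix e' assume e': "e' \<in> crr (anE Q)"
        then have "anp Q e' \<in> crr (anA Q)"
          using Q by (auto simp: is_andiag_def is_equivariant_def)
        then obtain a where "a \<in> crr (anA P)" "f a = anp Q e'"
          using bf by (metis bij_betw_def imageE)
        then show "e' \<in> g ` crr (anE P)"
          using is_pullback_lift[OF pb _ e'] by blast
      qed
    qed
  qed
  define f' where "f' = (\<lambda>a\<in>crr (anA Q). inv_into (crr (anA P)) f a)"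
  define g' where "g' = (\<lambda>e\<in>crr (anE Q). inv_into (crr (anE P)) g e)"
  define u' where "u' = (\<lambda>x\<in>asorts Q. inv_into (asorts P) u x)"
  have inv: "f a \<in> crr (anA Q)" "f' (f a) = a" if "a \<in> crr (anA P)" for a
    using that bf by (auto simp: f'_def bij_betw_def)
  have inv_g: "g e \<in> crr (anE Q)" "g' (g e) = e" if "e \<in> crr (anE P)" for e
    using that bg by (auto simp: g'_def bij_betw_def)
  have inv_u: "u x \<in> asorts Q" "u' (u x) = x" if "x \<in> asorts P" for x
    using that bu by (auto simp: u'_def bij_betw_def)
  have f_inv: "f' a \<in> crr (anA P)" "f (f' a) = a" if "a \<in> crr (anA Q)" for a
    using that bf by (auto simp: f'_def bij_betw_def intro: inv_into_into f_inv_into_f)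
  have g_inv: "g' e \<in> crr (anE P)" "g (g' e) = e" if "e \<in> crr (anE Q)" for e
    using that bg by (auto simp: g'_def bij_betw_def intro: inv_into_into f_inv_into_f)
  have u_inv: "u' x \<in> asorts P" "u (u' x) = x" if "x \<in> asorts Q" for x
    using that bu by (auto simp: u'_def bij_betw_def intro: inv_into_into f_inv_into_f)
  have u'u: "delta_map u' (delta_map u z) = z" if "z \<in> crr (delta (asorts P))" for z
    using that inv_u by (auto simp: delta_map_def delta_def)
  have memP: "anp P e \<in> crr (anA P)" "ans P e \<in> crr (delta (asorts P))"
    if "e \<in> crr (anE P)" for e
    using that P by (auto simp: is_andiag_def is_equivariant_def)
  have memP': "ant P a \<in> crr (delta (asorts P))" if "a \<in> crr (anA P)" for a
    using that P by (auto simp: is_andiag_def is_equivariant_def)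
  \<comment> \<open>Between analytic diagrams the pullback clause reduces to commutativity of the
    square, so only the latter has to be tested for the inverse.\<close>
  have m': "is_andiag_mor Q P (f', g', u')"
    unfolding is_andiag_mor_iff[OF Q P]
  proof (intro conjI ballI)
    show "is_equivariant (anA Q) (anA P) f'" "is_equivariant (anE Q) (anE P) g'"
      unfolding f'_def g'_def using P Q bf bg is_andiag_morD[OF m]
      by (auto simp: is_andiag_def intro: is_equivariant_inv_into)
    show "f' \<in> extensional (crr (anA Q))" "g' \<in> extensional (crr (anE Q))"
      by (simp_all add: f'_def g'_def)
    show "u' \<in> asorts Q \<rightarrow>\<^sub>E asorts P"
      using u_inv by (auto simp: PiE_iff) (simp add: u'_def)
  next
    \<comment> \<open>Writing \<open>e'\<close> as \<open>g e\<close> turns each condition on the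
      inverse into one on \<open>(f, g, u)\<close> at \<open>e\<close>, after cancelling
      \<open>f'\<close>, \<open>g'\<close> and \<open>u'\<close>.\<close>
    fix e' assume "e' \<in> crr (anE Q)"
    then obtain e where e: "e \<in> crr (anE P)" "e' = g e"
      using g_inv by metis
    show "ans P (g' e') = delta_map u' (ans Q e')" "f' (anp Q e') = anp P (g' e')"
        "anr P (g' e') = anr Q e'"
      using m e memP inv inv_g u'u is_andiag_morD(3)[OF m]
      by (auto simp: is_andiag_mor_def simp flip: is_andiag_morD(3)[OF m])
  next
    fix a' assume "a' \<in> crr (anA Q)"
    then obtain a where a: "a \<in> crr (anA P)" "a' = f a"
      using f_inv by metis
    show "ant P (f' a') = delta_map u' (ant Q a')"
      using m a memP' inv u'u by (simp add: is_andiag_mor_def)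
  qed
  have "compose (crr (anA P)) f' f = (\<lambda>a\<in>crr (anA P). a)"
       "compose (crr (anE P)) g' g = (\<lambda>e\<in>crr (anE P). e)"
       "compose (asorts P) u' u = (\<lambda>x\<in>asorts P. x)"
       "compose (crr (anA Q)) f f' = (\<lambda>a\<in>crr (anA Q). a)"
       "compose (crr (anE Q)) g g' = (\<lambda>e\<in>crr (anE Q). e)"
       "compose (asorts Q) u u' = (\<lambda>x\<in>asorts Q. x)"
    using inv inv_g inv_u f_inv g_inv u_inv
    by (auto simp: compose_def intro!: restrict_ext)
  then show ?thesis
    unfolding is_iso_def using m m' by (auto simp: AnDiag_def intro!: bexI[of _ "(f', g', u')"])
qed

subsection \<open>The functors\<close>

lemma iota_a_ob_simps [simp]:
  "psorts (iota_a_ob S) = sorts S"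
  "pE (iota_a_ob S) = {\<langle>a, Idx i\<rangle> | a i. a \<in> ops S \<and> i \<in> {1..arity S a}}"
  "pA (iota_a_ob S) = ops S"
  "ps (iota_a_ob S) \<langle>a, Idx i\<rangle> = bd S a i"
  "pp (iota_a_ob S) \<langle>a, Idx i\<rangle> = a"
  "pt (iota_a_ob S) a = bd S a 0"
  by (simp_all add: iota_a_ob_def)

lemma K_sig_ob_simps [simp]:
  "ssorts (K_sig_ob S) = sorts S"
  "crr (K_sig_ob S) = {\<langle>a, Prm \<tau>\<rangle> | a \<tau>. a \<in> ops S \<and> \<tau> \<in> Sym (arity S a)}"
  "grd (K_sig_ob S) \<langle>a, Prm \<tau>\<rangle> = arity S a"
  "act (K_sig_ob S) \<langle>a, Prm \<tau>\<rangle> \<tau>' = \<langle>a, Prm (\<tau> \<circ> \<tau>')\<rangle>"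
  "sbd (K_sig_ob S) \<langle>a, Prm \<tau>\<rangle> i = bd S a (\<tau> i)"
  by (simp_all add: K_sig_ob_def)

lemma iota_s_ob_simps [simp]:
  "asorts (iota_s_ob S) = ssorts S"
  "crr (anA (iota_s_ob S)) = crr S"
  "grd (anA (iota_s_ob S)) = grd S"
  "act (anA (iota_s_ob S)) = act S"
  "crr (anE (iota_s_ob S)) = {\<langle>a, Idx i\<rangle> | a i. a \<in> crr S \<and> i \<in> {1..grd S a}}"
  "grd (anE (iota_s_ob S)) \<langle>a, Idx i\<rangle> = grd S a"
  "act (anE (iota_s_ob S)) \<langle>a, Idx i\<rangle> \<sigma> = \<langle>act S a \<sigma>, Idx (inv \<sigma> i)\<rangle>"
  "ans (iota_s_ob S) \<langle>a, Idx i\<rangle> = (grd S a, sbd S a i)"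
  "anp (iota_s_ob S) \<langle>a, Idx i\<rangle> = a"
  "ant (iota_s_ob S) a = (grd S a, sbd S a 0)"
  "anr (iota_s_ob S) \<langle>a, Idx i\<rangle> = (grd S a, i)"
  by (simp_all add: iota_s_ob_def)

text \<open>The condition for membership in the operations of \<open>K_diag_ob P\<close>. As a
  single predicate it stays folded under simplification, so its closure under the action and under
  morphisms can be used as one fact.\<close>

definition fibre_enum :: "('x elem, 'x elem, 'o) pdiag \<Rightarrow> 'x elem \<Rightarrow> (nat \<Rightarrow> 'x elem) \<Rightarrow> bool" where
  "fibre_enum P a h \<longleftrightarrow> a \<in> pA P \<and> h \<in> extensional {1..card (pfib P a)} \<and>
     bij_betw h {1..card (pfib P a)} (pfib P a)"

lemma K_diag_ob_simps [simp]:
  "asorts (K_diag_ob P) = psorts P"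
  "crr (anA (K_diag_ob P)) = {\<langle>a, Fn h\<rangle> | a h. fibre_enum P a h}"
  "grd (anA (K_diag_ob P)) \<langle>a, Fn h\<rangle> = card (pfib P a)"
  "act (anA (K_diag_ob P)) \<langle>a, Fn h\<rangle> \<tau> = \<langle>a, Fn (h \<circ> \<tau>)\<rangle>"
  "crr (anE (K_diag_ob P)) =
    {\<langle>\<langle>a, Fn h\<rangle>, Idx i\<rangle> | a h i. fibre_enum P a h \<and> i \<in> {1..card (pfib P a)}}"
  "grd (anE (K_diag_ob P)) \<langle>\<langle>a, Fn h\<rangle>, Idx i\<rangle> = card (pfib P a)"
  "act (anE (K_diag_ob P)) \<langle>\<langle>a, Fn h\<rangle>, Idx i\<rangle> \<tau> = \<langle>\<langle>a, Fn (h \<circ> \<tau>)\<rangle>, Idx (inv \<tau> i)\<rangle>"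
  "ans (K_diag_ob P) \<langle>\<langle>a, Fn h\<rangle>, Idx i\<rangle> = (card (pfib P a), ps P (h i))"
  "anp (K_diag_ob P) \<langle>\<langle>a, Fn h\<rangle>, Idx i\<rangle> = \<langle>a, Fn h\<rangle>"
  "ant (K_diag_ob P) \<langle>a, Fn h\<rangle> = (card (pfib P a), pt P a)"
  "anr (K_diag_ob P) \<langle>\<langle>a, Fn h\<rangle>, Idx i\<rangle> = (card (pfib P a), i)"
  by (simp_all add: K_diag_ob_def Let_def fibre_enum_def)

lemma RR_simps [simp]:
  "crr RR = {(n, i). i \<in> {1..n}}" "grd RR (n, i) = n" "act RR (n, i) \<tau> = (n, inv \<tau> i)"
  by (simp_all add: RR_def)

lemma delta_simps [simp]:
  "crr (delta X) = UNIV \<times> X" "grd (delta X) z = fst z" "act (delta X) z \<sigma> = z"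
  by (simp_all add: delta_def)

lemma Sym_inv_range: "\<sigma> \<in> Sym n \<Longrightarrow> inv \<sigma> i \<in> {1..n} \<longleftrightarrow> i \<in> {1..n}"
  by (rule Sym_range[OF Sym_inv])

lemma Sym_inv_mem: "\<sigma> \<in> Sym n \<Longrightarrow> i \<in> {1..n} \<Longrightarrow> inv \<sigma> i \<in> {1..n}"
  using Sym_inv_range by blast

lemma is_sigaD: "\<lbrakk>is_siga S; a \<in> ops S; i \<le> arity S a\<rbrakk> \<Longrightarrow> bd S a i \<in> sorts S"
  unfolding is_siga_def by (metis PiE atLeastAtMost_iff zero_le)

lemma is_siga_morD:
  assumes "is_siga_mor S T (f, \<sigma>, u)" "a \<in> ops S"
  shows "f a \<in> ops T" "arity T (f a) = arity S a" "\<sigma> a \<in> Sym (arity S a)"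
    and "i \<in> {0..arity S a} \<Longrightarrow> bd T (f a) i = u (bd S a (\<sigma> a i))"
  using assms by (auto simp: is_siga_mor_def PiE_iff)

section \<open>The functor \<open>iota_a\<close>\<close>

lemma pfib_iota_a: "a \<in> ops S \<Longrightarrow> pfib (iota_a_ob S) a = (\<lambda>i. \<langle>a, Idx i\<rangle>) ` {1..arity S a}"
  by (auto simp: pfib_def)

text \<open>Reconciles the two gradings to be compared: \<open>K_diag\<close> counts a fibre,
  \<open>K_sig\<close> reads off the arity.\<close>

lemma card_pfib_iota_a: "a \<in> ops S \<Longrightarrow> card (pfib (iota_a_ob S) a) = arity S a"
  by (simp add: pfib_iota_a card_image inj_on_def)

lemma is_pdiag_iota_a: "is_siga S \<Longrightarrow> is_pdiag (iota_a_ob S)"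
  by (auto simp: is_pdiag_def is_sigaD pfib_iota_a)

text \<open>The map on E restricts to a bijection between the fibres over \<open>a\<close> and
  \<open>f a\<close>, because \<open>inv (\<sigma> a)\<close> permutes the inputs and arities are
  preserved; this is the pullback property.\<close>

lemma iota_a_mor:
  assumes "is_siga_mor S T (f, \<sigma>, u)"
  shows "is_pdiag_mor (iota_a_ob S) (iota_a_ob T) (FAr iota_a S T (f, \<sigma>, u))"
proof -
  note m = is_siga_morD[OF assms]
  define g where "g = (\<lambda>e\<in>pE (iota_a_ob S). case e of \<langle>a, Idx i\<rangle> \<Rightarrow> \<langle>f a, Idx (inv (\<sigma> a) i)\<rangle>)"
  have g: "g \<langle>a, Idx i\<rangle> = \<langle>f a, Idx (inv (\<sigma> a) i)\<rangle>" and r: "inv (\<sigma> a) i \<in> {1..arity T (f a)}"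
    if "a \<in> ops S" "i \<in> {1..arity S a}" for a i
    using that m Sym_inv_range[of "\<sigma> a"] by (auto simp: g_def)
  have pb: "is_pullback (pE (iota_a_ob S)) (pA (iota_a_ob S)) (pE (iota_a_ob T))
      (pp (iota_a_ob S)) g f (pp (iota_a_ob T))"
  proof (rule is_pullbackI)
    fix e assume "e \<in> pE (iota_a_ob S)"
    then show "pp (iota_a_ob S) e \<in> pA (iota_a_ob S)" "g e \<in> pE (iota_a_ob T)"
        "f (pp (iota_a_ob S) e) = pp (iota_a_ob T) (g e)"
      using g r m by auto
  next
    fix d e assume "d \<in> pE (iota_a_ob S)" "e \<in> pE (iota_a_ob S)"
      "pp (iota_a_ob S) d = pp (iota_a_ob S) e" "g d = g e"
    then obtain a i j where "d = \<langle>a, Idx i\<rangle>" "e = \<langle>a, Idx j\<rangle>" "a \<in> ops S"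
        "inv (\<sigma> a) i = inv (\<sigma> a) j"
      by (auto simp: g)
    moreover have "inj (inv (\<sigma> a))"
      using Sym_inv[OF m(3)] \<open>a \<in> ops S\<close> permutes_inj by blast
    ultimately show "d = e"
      by (simp add: inj_eq)
  next
    fix a e' assume a: "a \<in> pA (iota_a_ob S)" and "e' \<in> pE (iota_a_ob T)"
      and "f a = pp (iota_a_ob T) e'"
    then obtain i where i: "e' = \<langle>f a, Idx i\<rangle>" "i \<in> {1..arity S a}"
      using m by auto
    \<comment> \<open>The lift of input \<open>i\<close> of \<open>f a\<close> is the input that
      \<open>inv (\<sigma> a)\<close> sends to \<open>i\<close>.\<close>
    then have "\<sigma> a i \<in> {1..arity S a}" "inv (\<sigma> a) (\<sigma> a i) = i"
      using m(3)[of a] a Sym_range[of "\<sigma> a"] permutes_inverses[of "\<sigma> a"] by auto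
    with i a g[of a "\<sigma> a i"]
    show "\<exists>e\<in>pE (iota_a_ob S). pp (iota_a_ob S) e = a \<and> g e = e'"
      by (intro bexI[of _ "\<langle>a, Idx (\<sigma> a i)\<rangle>"]) auto
  qed
  \<comment> \<open>The boundary law at index \<open>inv (\<sigma> a) i\<close>, where
    \<open>\<sigma> a\<close> cancels.\<close>
  have "bd T (f a) (inv (\<sigma> a) i) = u (bd S a i)" if "a \<in> ops S" "i \<in> {1..arity S a}" for a i
    using m(4)[OF that(1), of "inv (\<sigma> a) i"] m(3)[OF that(1)] r[OF that] m(2)[OF that(1)]
    by (auto simp: permutes_inverses)
  \<comment> \<open>The output keeps its place: \<open>\<sigma> a\<close> fixes 0.\<close>
  moreover have "bd T (f a) 0 = u (bd S a 0)" if "a \<in> ops S" for a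
    using m(4)[OF that, of 0] m(3)[OF that] permutes_not_in[of "\<sigma> a" _ 0] by auto
  moreover have "g \<in> pE (iota_a_ob S) \<rightarrow>\<^sub>E pE (iota_a_ob T)"
    using pb is_pullback_memD[OF pb] by (auto simp: PiE_iff g_def simp del: iota_a_ob_simps)
  ultimately have "is_pdiag_mor (iota_a_ob S) (iota_a_ob T) (f, g, u)"
    using assms pb g unfolding is_pdiag_mor_def by (auto simp: is_siga_mor_def)
  then show ?thesis
    by (simp add: iota_a_def g_def)
qed

lemma is_functor_iota_a:
  "is_functor (Sig_a :: (('x elem, 'o) siga, ('x elem, 'o) siga_mor) cat) PolyDiag iota_a"
  unfolding is_functor_def
proof (intro conjI ballI is_category_Sig_a is_category_PolyDiag)
  fix S :: "('x elem, 'o) siga" assume "S \<in> Ob Sig_a"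
  then show "FOb iota_a S \<in> Ob PolyDiag"
    by (simp add: Sig_a_def PolyDiag_def iota_a_def is_pdiag_iota_a)
next
  fix S T :: "('x elem, 'o) siga" and x
  assume "x \<in> Hom Sig_a S T"
  then show "FAr iota_a S T x \<in> Hom PolyDiag (FOb iota_a S) (FOb iota_a T)"
    using iota_a_mor by (cases x) (auto simp: Sig_a_def PolyDiag_def iota_a_def)
next
  fix S :: "('x elem, 'o) siga"
  show "FAr iota_a S S (ide Sig_a S) = ide PolyDiag (FOb iota_a S)"
    by (auto simp: Sig_a_def PolyDiag_def iota_a_def intro!: restrict_ext)
next
  fix S T U :: "('x elem, 'o) siga" and x y
  assume x: "x \<in> Hom Sig_a S T" and y: "y \<in> Hom Sig_a T U"
  obtain f \<sigma> u g \<tau> v where xy: "x = (f, \<sigma>, u)" "y = (g, \<tau>, v)"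
    by (cases x; cases y)
  have mx: "is_siga_mor S T (f, \<sigma>, u)" and my: "is_siga_mor T U (g, \<tau>, v)"
    using x y by (auto simp: xy Sig_a_def)
  note mx = is_siga_morD[OF mx] and my = is_siga_morD[OF my]
  have "inv (\<sigma> a) i \<in> {1..arity T (f a)}" if "a \<in> ops S" "i \<in> {1..arity S a}" for a i
    using Sym_inv_range[OF mx(3)] mx(2) that by auto
  \<comment> \<open>Inversion reverses the order in \<open>\<sigma> a \<circ> \<tau> (f a)\<close>,
    and so the index maps compose in the same order as the morphisms.\<close>
  moreover have "inv (\<sigma> a \<circ> \<tau> (f a)) = inv (\<tau> (f a)) \<circ> inv (\<sigma> a)" if "a \<in> ops S" for a
    using Sym_inv_comp mx my that by blast
  ultimately show "FAr iota_a S U (cmp Sig_a S T U y x)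
      = cmp PolyDiag (FOb iota_a S) (FOb iota_a T) (FOb iota_a U)
          (FAr iota_a T U y) (FAr iota_a S T x)"
    using mx
    by (auto simp: xy Sig_a_def PolyDiag_def iota_a_def compose_def intro!: restrict_ext)
qed

section \<open>The functor \<open>K_sig\<close>\<close>

lemma is_sigs_K_sig:
  assumes "is_siga S" shows "is_sigs (K_sig_ob S)"
proof -
  have "is_symset (K_sig_ob S)"
    by (auto simp: is_symset_def comp_assoc permutes_compose)
  moreover have "bd S a (\<tau> i) \<in> sorts S"
    if "a \<in> ops S" "\<tau> \<in> Sym (arity S a)" "i \<in> {0..arity S a}" for a \<tau> i
    using is_sigaD[OF assms that(1)] Sym_range0[OF that(2), of i] that(3) by simp
  ultimately show ?thesis
    by (auto simp: is_sigs_def)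
qed

text \<open>A morphism multiplies \<tau> by \<open>inv (\<sigma> a)\<close> on the left while the
  action multiplies on the right, so equivariance is associativity.\<close>

lemma K_sig_mor:
  assumes "is_siga_mor S T (f, \<sigma>, u)"
  shows "is_sigs_mor (K_sig_ob S) (K_sig_ob T) (FAr K_sig S T (f, \<sigma>, u))"
proof -
  note m = is_siga_morD[OF assms]
  define s where
    "s = (\<lambda>x\<in>crr (K_sig_ob S). case x of \<langle>a, Prm \<tau>\<rangle> \<Rightarrow> \<langle>f a, Prm (inv (\<sigma> a) \<circ> \<tau>)\<rangle>)"
  have s: "s \<langle>a, Prm \<tau>\<rangle> = \<langle>f a, Prm (inv (\<sigma> a) \<circ> \<tau>)\<rangle>"
    if "a \<in> ops S" "\<tau> \<in> Sym (arity S a)" for a \<tau>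
    using that by (simp add: s_def)
  have p: "inv (\<sigma> a) \<circ> \<tau> \<in> Sym (arity S a)" if "a \<in> ops S" "\<tau> \<in> Sym (arity S a)" for a \<tau>
    using Sym_comp[OF Sym_inv[OF m(3)[OF that(1)]] that(2)] .
  have "is_equivariant (K_sig_ob S) (K_sig_ob T) s"
    using m p s Sym_comp by (auto simp: is_equivariant_def comp_assoc)
  moreover have "bd T (f a) (inv (\<sigma> a) (\<tau> i)) = u (bd S a (\<tau> i))"
    if "a \<in> ops S" "\<tau> \<in> Sym (arity S a)" "i \<in> {0..arity S a}" for a \<tau> i
    using m(4)[OF that(1), of "inv (\<sigma> a) (\<tau> i)"] m(3)[OF that(1)]
      Sym_range0[OF p[OF that(1,2)], of i] that(3) by (auto simp: permutes_inverses)
  ultimately have "is_sigs_mor (K_sig_ob S) (K_sig_ob T) (s, u)"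
    using assms s by (auto simp: is_sigs_mor_def is_siga_mor_def) (auto simp: s_def)
  then show ?thesis
    by (simp add: K_sig_def s_def)
qed

lemma is_functor_K_sig:
  "is_functor (Sig_a :: (('x elem, 'o) siga, ('x elem, 'o) siga_mor) cat) Sig_s K_sig"
  unfolding is_functor_def
proof (intro conjI ballI is_category_Sig_a is_category_Sig_s)
  fix S :: "('x elem, 'o) siga" assume "S \<in> Ob Sig_a"
  then show "FOb K_sig S \<in> Ob Sig_s"
    by (simp add: Sig_a_def Sig_s_def K_sig_def is_sigs_K_sig)
next
  fix S T :: "('x elem, 'o) siga" and x
  assume "x \<in> Hom Sig_a S T"
  then show "FAr K_sig S T x \<in> Hom Sig_s (FOb K_sig S) (FOb K_sig T)"
    using K_sig_mor by (cases x) (auto simp: Sig_a_def Sig_s_def K_sig_def)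
next
  fix S :: "('x elem, 'o) siga"
  show "FAr K_sig S S (ide Sig_a S) = ide Sig_s (FOb K_sig S)"
    by (auto simp: Sig_a_def Sig_s_def K_sig_def intro!: restrict_ext)
next
  fix S T U :: "('x elem, 'o) siga" and x y
  assume x: "x \<in> Hom Sig_a S T" and y: "y \<in> Hom Sig_a T U"
  obtain f \<sigma> u g \<tau> v where xy: "x = (f, \<sigma>, u)" "y = (g, \<tau>, v)"
    by (cases x; cases y)
  have mx: "is_siga_mor S T (f, \<sigma>, u)" and my: "is_siga_mor T U (g, \<tau>, v)"
    using x y by (auto simp: xy Sig_a_def)
  note mx = is_siga_morD[OF mx] and my = is_siga_morD[OF my]
  have "inv (\<sigma> a) \<circ> \<rho> \<in> Sym (arity T (f a))" if "a \<in> ops S" "\<rho> \<in> Sym (arity S a)" for a \<rho>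
    using Sym_comp[OF Sym_inv[OF mx(3)[OF that(1)]] that(2)] mx(2) that by auto
  moreover have "inv (\<sigma> a \<circ> \<tau> (f a)) = inv (\<tau> (f a)) \<circ> inv (\<sigma> a)" if "a \<in> ops S" for a
    using Sym_inv_comp mx my that by blast
  ultimately show "FAr K_sig S U (cmp Sig_a S T U y x)
      = cmp Sig_s (FOb K_sig S) (FOb K_sig T) (FOb K_sig U)
          (FAr K_sig T U y) (FAr K_sig S T x)"
    using mx
    by (auto simp: xy Sig_a_def Sig_s_def K_sig_def compose_def comp_assoc intro!: restrict_ext)
qed

section \<open>The functor \<open>iota_s\<close>\<close>

lemma is_andiag_iota_s:
  assumes "is_sigs S" shows "is_andiag (iota_s_ob S)"
proof -
  have S: "is_symset S"
    using assms by (simp add: is_sigs_def)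
  have bd: "sbd S a i \<in> ssorts S" if "a \<in> crr S" "i \<in> {0..grd S a}" for a i
    using assms that unfolding is_sigs_def by (metis funcset_mem)
  have bd_act: "sbd S (act S a \<sigma>) i = sbd S a (\<sigma> i)"
    if "a \<in> crr S" "\<sigma> \<in> Sym (grd S a)" "i \<in> {0..grd S a}" for a \<sigma> i
    using assms that by (simp add: is_sigs_def)
  have act: "act S a \<sigma> \<in> crr S" "grd S (act S a \<sigma>) = grd S a"
    if "a \<in> crr S" "\<sigma> \<in> Sym (grd S a)" for a \<sigma>
    using is_symsetD[OF S] that by blast+
  have act_comp: "act S a id = a"
      "\<lbrakk>\<sigma> \<in> Sym (grd S a); \<tau> \<in> Sym (grd S a)\<rbrakk> \<Longrightarrow> act S (act S a \<sigma>) \<tau> = act S a (\<sigma> \<circ> \<tau>)"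
    if "a \<in> crr S" for a \<sigma> \<tau>
    using S that by (auto simp: is_symset_def)
  have "is_symset (anA (iota_s_ob S))"
    using S by (simp add: is_symset_def)
  \<comment> \<open>Indices are moved by the inverse permutation; the reversal of order under
    inversion makes this a right action.\<close>
  moreover have "is_symset (anE (iota_s_ob S))"
    using act act_comp Sym_inv_mem by (auto simp: is_symset_def Sym_inv_comp[simplified])
  \<comment> \<open>The action on \<delta> is trivial, so the sort must be invariant: the boundary
    is precomposed with \<sigma>, the index is moved by \<open>inv \<sigma>\<close>, and the two
    cancel.\<close>
  moreover have "is_equivariant (anE (iota_s_ob S)) (delta (asorts (iota_s_ob S))) (ans (iota_s_ob S))"
    using act bd bd_act Sym_inv_mem by (fastforce simp: is_equivariant_def permutes_inverses)
  moreover have "is_equivariant (anE (iota_s_ob S)) (anA (iota_s_ob S)) (anp (iota_s_ob S))"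
    by (auto simp: is_equivariant_def)
  moreover have "is_equivariant (anA (iota_s_ob S)) (delta (asorts (iota_s_ob S))) (ant (iota_s_ob S))"
    using act bd bd_act by (auto simp: is_equivariant_def permutes_not_in)
  moreover have "is_equivariant (anE (iota_s_ob S)) RR (anr (iota_s_ob S))"
    using act by (auto simp: is_equivariant_def)
  moreover have "is_pullback (crr (anE (iota_s_ob S))) (crr (anA (iota_s_ob S))) (crr RR)
      (anp (iota_s_ob S)) (anr (iota_s_ob S)) (to_delta1 (anA (iota_s_ob S))) (to_delta1 RR)"
  proof (rule is_pullbackI)
    fix a e' assume a: "a \<in> crr (anA (iota_s_ob S))" and "e' \<in> crr RR"
      and "to_delta1 (anA (iota_s_ob S)) a = to_delta1 RR e'"
    then obtain i where "e' = (grd (anA (iota_s_ob S)) a, i)" "i \<in> {1..grd (anA (iota_s_ob S)) a}"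
      by (auto simp: to_delta1_def)
    with a show "\<exists>e\<in>crr (anE (iota_s_ob S)). anp (iota_s_ob S) e = a \<and> anr (iota_s_ob S) e = e'"
      by (intro bexI[of _ "\<langle>a, Idx i\<rangle>"]) auto
  qed (auto simp: to_delta1_def)
  ultimately show ?thesis
    by (simp add: is_andiag_def)
qed

lemma iota_s_mor:
  assumes S: "is_sigs S" and T: "is_sigs T" and m: "is_sigs_mor S T (f, u)"
  shows "is_andiag_mor (iota_s_ob S) (iota_s_ob T) (FAr iota_s S T (f, u))"
proof -
  have f: "f a \<in> crr T" "grd T (f a) = grd S a"
    "\<And>\<sigma>. \<sigma> \<in> Sym (grd S a) \<Longrightarrow> f (act S a \<sigma>) = act T (f a) \<sigma>"
    "\<And>\<sigma>. \<sigma> \<in> Sym (grd S a) \<Longrightarrow> act S a \<sigma> \<in> crr S \<and> grd S (act S a \<sigma>) = grd S a"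
    "\<And>i. i \<in> {0..grd S a} \<Longrightarrow> sbd T (f a) i = u (sbd S a i)"
    if "a \<in> crr S" for a
    using m S that by (auto simp: is_sigs_mor_def is_equivariant_def is_sigs_def is_symset_def)
  have u: "f \<in> extensional (crr S)" "u \<in> ssorts S \<rightarrow>\<^sub>E ssorts T"
    using m by (auto simp: is_sigs_mor_def)
  have "is_equivariant (anA (iota_s_ob S)) (anA (iota_s_ob T)) f"
    using f by (auto simp: is_equivariant_def)
  moreover have "is_equivariant (anE (iota_s_ob S)) (anE (iota_s_ob T))
      (\<lambda>e\<in>crr (anE (iota_s_ob S)). case e of \<langle>a, Idx i\<rangle> \<Rightarrow> \<langle>f a, Idx i\<rangle>)"
    using f Sym_inv_mem by (auto simp: is_equivariant_def)
  ultimately show ?thesis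
    using is_andiag_mor_iff[OF is_andiag_iota_s[OF S] is_andiag_iota_s[OF T]] f u
    by (auto simp: iota_s_def delta_map_def)
qed

lemma is_functor_iota_s:
  "is_functor (Sig_s :: (('x elem, 'o) sigs, ('x elem, 'o) sigs_mor) cat) AnDiag iota_s"
  unfolding is_functor_def
proof (intro conjI ballI is_category_Sig_s is_category_AnDiag)
  fix S :: "('x elem, 'o) sigs" assume "S \<in> Ob Sig_s"
  then show "FOb iota_s S \<in> Ob AnDiag"
    by (simp add: Sig_s_def AnDiag_def iota_s_def is_andiag_iota_s)
next
  fix S T :: "('x elem, 'o) sigs" and x
  assume "S \<in> Ob Sig_s" "T \<in> Ob Sig_s" "x \<in> Hom Sig_s S T"
  then show "FAr iota_s S T x \<in> Hom AnDiag (FOb iota_s S) (FOb iota_s T)"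
    using iota_s_mor by (cases x) (auto simp: Sig_s_def AnDiag_def iota_s_def)
next
  fix S :: "('x elem, 'o) sigs"
  show "FAr iota_s S S (ide Sig_s S) = ide AnDiag (FOb iota_s S)"
    by (auto simp: Sig_s_def AnDiag_def iota_s_def intro!: restrict_ext)
next
  fix S T U :: "('x elem, 'o) sigs" and x y
  assume x: "x \<in> Hom Sig_s S T" and "y \<in> Hom Sig_s T U"
  obtain f u g v where xy: "x = (f, u)" "y = (g, v)"
    by (cases x; cases y)
  have "f a \<in> crr T" "grd T (f a) = grd S a" if "a \<in> crr S" for a
    using x that by (auto simp: xy Sig_s_def is_sigs_mor_def is_equivariant_def)
  then show "FAr iota_s S U (cmp Sig_s S T U y x)
      = cmp AnDiag (FOb iota_s S) (FOb iota_s T) (FOb iota_s U)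
          (FAr iota_s T U y) (FAr iota_s S T x)"
    by (auto simp: xy Sig_s_def AnDiag_def iota_s_def compose_def intro!: restrict_ext)
qed

section \<open>The functor \<open>K_diag\<close>\<close>

lemma fibre_enum_Sym:
  "\<lbrakk>fibre_enum P a h; \<tau> \<in> Sym (card (pfib P a))\<rbrakk> \<Longrightarrow> fibre_enum P a (h \<circ> \<tau>)"
  unfolding fibre_enum_def using extensional_comp_Sym bij_betw_comp_Sym by blast

lemma fibre_enum_mem:
  assumes "fibre_enum P a h" "i \<in> {1..card (pfib P a)}"
  shows "a \<in> pA P" "h i \<in> pE P" "pp P (h i) = a"
proof -
  show "a \<in> pA P"
    using assms(1) by (simp add: fibre_enum_def)
  have "h i \<in> pfib P a"
    using assms bij_betwE unfolding fibre_enum_def by blast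
  then show "h i \<in> pE P" "pp P (h i) = a"
    by (simp_all add: pfib_def)
qed

lemma is_andiag_K_diag:
  assumes P: "is_pdiag P" shows "is_andiag (K_diag_ob P)"
proof -
  note [simp] = fibre_enum_Sym[simplified]
  have bd: "ps P (h i) \<in> psorts P" if "fibre_enum P a h" "i \<in> {1..card (pfib P a)}" for a h i
    using P fibre_enum_mem(2)[OF that] by (auto simp: is_pdiag_def)
  have bd0: "pt P a \<in> psorts P" if "fibre_enum P a h" for a h
    using P that by (auto simp: is_pdiag_def fibre_enum_def)
  have "is_symset (anA (K_diag_ob P))"
    by (auto simp: is_symset_def comp_assoc)
  moreover have "is_symset (anE (K_diag_ob P))"
    using Sym_inv_mem Sym_inv_comp by (auto simp: is_symset_def comp_assoc)
  \<comment> \<open>At the moved index \<open>inv \<tau> i\<close> the enumeration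
    \<open>h \<circ> \<tau>\<close> still takes the value \<open>h i\<close>.\<close>
  moreover have "is_equivariant (anE (K_diag_ob P)) (delta (asorts (K_diag_ob P))) (ans (K_diag_ob P))"
    using bd by (auto simp: is_equivariant_def permutes_inverses)
  moreover have "is_equivariant (anE (K_diag_ob P)) (anA (K_diag_ob P)) (anp (K_diag_ob P))"
    by (auto simp: is_equivariant_def)
  moreover have "is_equivariant (anA (K_diag_ob P)) (delta (asorts (K_diag_ob P))) (ant (K_diag_ob P))"
    using bd0 by (auto simp: is_equivariant_def)
  moreover have "is_equivariant (anE (K_diag_ob P)) RR (anr (K_diag_ob P))"
    by (auto simp: is_equivariant_def)
  moreover have "is_pullback (crr (anE (K_diag_ob P))) (crr (anA (K_diag_ob P))) (crr RR)
      (anp (K_diag_ob P)) (anr (K_diag_ob P)) (to_delta1 (anA (K_diag_ob P))) (to_delta1 RR)"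
  proof (rule is_pullbackI)
    fix a e' assume a: "a \<in> crr (anA (K_diag_ob P))" and "e' \<in> crr RR"
      and "to_delta1 (anA (K_diag_ob P)) a = to_delta1 RR e'"
    then obtain i where "e' = (grd (anA (K_diag_ob P)) a, i)" "i \<in> {1..grd (anA (K_diag_ob P)) a}"
      by (auto simp: to_delta1_def)
    with a show "\<exists>e\<in>crr (anE (K_diag_ob P)). anp (K_diag_ob P) e = a \<and> anr (K_diag_ob P) e = e'"
      by (intro bexI[of _ "\<langle>a, Idx i\<rangle>"]) auto
  qed (auto simp: to_delta1_def)
  ultimately show ?thesis
    by (simp add: is_andiag_def)
qed

text \<open>Over a fixed \<open>a\<close>, joint injectivity of \<open>p\<close> and
  \<open>g\<close> is injectivity of \<open>g\<close>, and lifting of pairs is surjectivity. This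
  lets \<open>K_diag\<close> carry enumerations of the fibre over \<open>a\<close> to enumerations
  of the fibre over \<open>f a\<close>.\<close>

lemma bij_betw_pfib:
  assumes pb: "is_pullback (pE P) (pA P) (pE Q) (pp P) g f (pp Q)" and a: "a \<in> pA P"
  shows "bij_betw g (pfib P a) (pfib Q (f a))"
  unfolding bij_betw_def
proof
  show "inj_on g (pfib P a)"
    by (rule inj_onI) (auto simp: pfib_def intro: is_pullback_eqI[OF pb])
  show "g ` pfib P a = pfib Q (f a)"
  proof
    show "g ` pfib P a \<subseteq> pfib Q (f a)"
      using is_pullback_memD[OF pb] is_pullback_commutes[OF pb] by (force simp: pfib_def)
  next
    show "pfib Q (f a) \<subseteq> g ` pfib P a"
    proof
      fix e' assume "e' \<in> pfib Q (f a)"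
      then obtain e where "e \<in> pE P" "pp P e = a" "g e = e'"
        using is_pullback_lift[OF pb a, of e'] by (auto simp: pfib_def)
      then show "e' \<in> g ` pfib P a"
        by (auto simp: pfib_def)
    qed
  qed
qed

lemma pdiag_mor_pfib:
  assumes "is_pdiag_mor P Q (f, g, u)" "a \<in> pA P"
  shows "bij_betw g (pfib P a) (pfib Q (f a))" "card (pfib Q (f a)) = card (pfib P a)"
proof -
  show "bij_betw g (pfib P a) (pfib Q (f a))"
    using assms bij_betw_pfib by (auto simp: is_pdiag_mor_def)
  then show "card (pfib Q (f a)) = card (pfib P a)"
    using bij_betw_same_card by fastforce
qed

lemma fibre_enum_compose:
  assumes m: "is_pdiag_mor P Q (f, g, u)" and h: "fibre_enum P a h"
  shows "fibre_enum Q (f a) (compose {1..card (pfib P a)} g h)"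
proof -
  let ?n = "card (pfib P a)"
  have a: "a \<in> pA P" "bij_betw h {1..?n} (pfib P a)"
    using h by (simp_all add: fibre_enum_def)
  then have "bij_betw (g \<circ> h) {1..?n} (pfib Q (f a))"
    using pdiag_mor_pfib(1)[OF m] bij_betw_trans by blast
  then have "bij_betw (compose {1..?n} g h) {1..?n} (pfib Q (f a))"
    using bij_betw_cong[of "{1..?n}" "g \<circ> h" "compose {1..?n} g h"] by (simp add: compose_eq)
  then show ?thesis
    using m a(1) pdiag_mor_pfib(2)[OF m a(1)] compose_extensional[of "{1..?n}" g h]
    by (auto simp: fibre_enum_def is_pdiag_mor_def)
qed

text \<open>The map \<open>g\<close> acts on the values of \<open>h\<close> and permutations act on
  its arguments, so the two operations commute.\<close>

lemma K_diag_mor: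
  assumes P: "is_pdiag P" and Q: "is_pdiag Q" and m: "is_pdiag_mor P Q (f, g, u)"
  shows "is_andiag_mor (K_diag_ob P) (K_diag_ob Q) (FAr K_diag P Q (f, g, u))"
proof -
  note [simp] = fibre_enum_Sym[simplified] fibre_enum_compose[OF m, simplified]
    compose_comp_Sym[simplified]
  have card_eq [simp]: "card (pfib Q (f a)) = card (pfib P a)" if "fibre_enum P a h" for a h
    using pdiag_mor_pfib(2)[OF m] that by (simp add: fibre_enum_def)
  have s: "ps Q (g (h i)) = u (ps P (h i))"
    if "fibre_enum P a h" "i \<in> {1..card (pfib P a)}" for a h i
    using m fibre_enum_mem(2)[OF that] by (simp add: is_pdiag_mor_def)
  have t: "pt Q (f a) = u (pt P a)" if "fibre_enum P a h" for a h
    using m that by (simp add: is_pdiag_mor_def fibre_enum_def)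
  have u: "u \<in> psorts P \<rightarrow>\<^sub>E psorts Q"
    using m by (simp add: is_pdiag_mor_def)
  define f' where "f' = (\<lambda>x\<in>crr (anA (K_diag_ob P)). case x of \<langle>a, Fn h\<rangle> \<Rightarrow>
    \<langle>f a, Fn (compose {1..card (pfib P a)} g h)\<rangle>)"
  define g' where "g' = (\<lambda>e\<in>crr (anE (K_diag_ob P)). case e of \<langle>\<langle>a, Fn h\<rangle>, Idx i\<rangle> \<Rightarrow>
    \<langle>\<langle>f a, Fn (compose {1..card (pfib P a)} g h)\<rangle>, Idx i\<rangle>)"
  have f' [simp]: "f' \<langle>a, Fn h\<rangle> = \<langle>f a, Fn (compose {1..card (pfib P a)} g h)\<rangle>"
    if "fibre_enum P a h" for a h
    using that by (simp add: f'_def)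
  have g' [simp]: "g' \<langle>\<langle>a, Fn h\<rangle>, Idx i\<rangle>
      = \<langle>\<langle>f a, Fn (compose {1..card (pfib P a)} g h)\<rangle>, Idx i\<rangle>"
    if "fibre_enum P a h" "i \<in> {1..card (pfib P a)}" for a h i
    using that by (simp add: g'_def)
  have "is_equivariant (anA (K_diag_ob P)) (anA (K_diag_ob Q)) f'"
    by (auto simp: is_equivariant_def)
  moreover have "is_equivariant (anE (K_diag_ob P)) (anE (K_diag_ob Q)) g'"
    using Sym_inv_mem by (auto simp: is_equivariant_def)
  moreover have "f' \<in> extensional (crr (anA (K_diag_ob P)))"
      "g' \<in> extensional (crr (anE (K_diag_ob P)))"
    by (simp_all add: f'_def g'_def)
  ultimately have "is_andiag_mor (K_diag_ob P) (K_diag_ob Q) (f', g', u)"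
    unfolding is_andiag_mor_iff[OF is_andiag_K_diag[OF P] is_andiag_K_diag[OF Q]]
    using u s t by (auto simp: delta_map_def compose_eq)
  then show ?thesis
    by (simp only: K_diag_def f'_def g'_def fctr.simps prod.case)
qed

lemma is_functor_K_diag:
  "is_functor (PolyDiag :: (('x elem, 'x elem, 'o) pdiag, ('x elem, 'x elem, 'o) diag_mor) cat)
     AnDiag K_diag"
  unfolding is_functor_def
proof (intro conjI ballI is_category_PolyDiag is_category_AnDiag)
  fix P :: "('x elem, 'x elem, 'o) pdiag" assume "P \<in> Ob PolyDiag"
  then show "FOb K_diag P \<in> Ob AnDiag"
    by (simp add: PolyDiag_def AnDiag_def K_diag_def is_andiag_K_diag)
next
  fix P Q :: "('x elem, 'x elem, 'o) pdiag" and x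
  assume "P \<in> Ob PolyDiag" "Q \<in> Ob PolyDiag" "x \<in> Hom PolyDiag P Q"
  then show "FAr K_diag P Q x \<in> Hom AnDiag (FOb K_diag P) (FOb K_diag Q)"
    using K_diag_mor by (cases x) (auto simp: PolyDiag_def AnDiag_def K_diag_def)
next
  fix P :: "('x elem, 'x elem, 'o) pdiag"
  \<comment> \<open>The identity of \<open>P\<close> is cut off to \<open>pE P\<close>, which
    contains the values of \<open>h\<close>; outside the index range both sides are
    \<open>undefined\<close>.\<close>
  have "compose {1..card (pfib P a)} (\<lambda>e\<in>pE P. e) h = h" if "fibre_enum P a h" for a h
    using that fibre_enum_mem(2)[OF that]
    by (auto simp: fun_eq_iff compose_def restrict_def fibre_enum_def extensional_def)
  then show "FAr K_diag P P (ide PolyDiag P) = ide AnDiag (FOb K_diag P)"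
    by (auto simp: PolyDiag_def AnDiag_def K_diag_def fibre_enum_def intro!: restrict_ext)
next
  fix P Q R :: "('x elem, 'x elem, 'o) pdiag" and x y
  assume x: "x \<in> Hom PolyDiag P Q" and "y \<in> Hom PolyDiag Q R"
  obtain f g u f' g' u' where xy: "x = (f, g, u)" "y = (f', g', u')"
    by (cases x; cases y)
  have m: "is_pdiag_mor P Q (f, g, u)"
    using x by (auto simp: xy PolyDiag_def)
  \<comment> \<open>Two cutoffs have to be matched: the one to \<open>pE P\<close> is invisible on
    values of \<open>h\<close>, and the index range counted in \<open>Q\<close> equals the one
    counted in \<open>P\<close>.\<close>
  have "compose {1..card (pfib P a)} (compose (pE P) g' g) h
      = compose {1..card (pfib Q (f a))} g' (compose {1..card (pfib P a)} g h)"
    and "card (pfib Q (f a)) = card (pfib P a)" and "a \<in> pA P"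
    if h: "fibre_enum P a h" for a h
  proof -
    show a: "a \<in> pA P"
      using h by (simp add: fibre_enum_def)
    show "card (pfib Q (f a)) = card (pfib P a)"
      by (rule pdiag_mor_pfib(2)[OF m a])
    then show "compose {1..card (pfib P a)} (compose (pE P) g' g) h
        = compose {1..card (pfib Q (f a))} g' (compose {1..card (pfib P a)} g h)"
      using fibre_enum_mem(2)[OF h] by (auto simp: compose_def intro!: restrict_ext)
  qed
  then show "FAr K_diag P R (cmp PolyDiag P Q R y x)
      = cmp AnDiag (FOb K_diag P) (FOb K_diag Q) (FOb K_diag R)
          (FAr K_diag Q R y) (FAr K_diag P Q x)"
    using fibre_enum_compose[OF m]
    by (auto simp: xy PolyDiag_def AnDiag_def K_diag_def compose_eq[of _ "pA P"]
        compose_def[of "crr _"] intro!: restrict_ext)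
qed

subsection \<open>The transformation\<close>

lemma fibre_enum_iota_a:
  "fibre_enum (iota_a_ob S) a h \<longleftrightarrow> a \<in> ops S \<and> h \<in> extensional {1..arity S a} \<and>
     bij_betw h {1..arity S a} ((\<lambda>i. \<langle>a, Idx i\<rangle>) ` {1..arity S a})"
proof (cases "a \<in> ops S")
  case True
  show ?thesis
    unfolding fibre_enum_def card_pfib_iota_a[OF True]
    unfolding pfib_iota_a[OF True] by simp
qed (simp add: fibre_enum_def)

text \<open>The first coordinate of \<open>h i\<close> is forced to be \<open>a\<close>, so the
  second projection loses no information.\<close>

lemma pi2_comp_nth:
  assumes "fibre_enum (iota_a_ob S) a h" "i \<in> {1..arity S a}"
  shows "h i = \<langle>a, Idx (pi2_comp (arity S a) h i)\<rangle>"
proof -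
  have "h i \<in> (\<lambda>i. \<langle>a, Idx i\<rangle>) ` {1..arity S a}"
    using assms bij_betwE unfolding fibre_enum_iota_a by blast
  with assms(2) show ?thesis
    by (auto simp: pi2_comp_def)
qed

text \<open>The second projection maps the fibre bijectively onto (|a|]. The identity as default
  outside this range is what \<open>permutes\<close> demands.\<close>

lemma pi2_comp_Sym:
  assumes h: "fibre_enum (iota_a_ob S) a h"
  shows "pi2_comp (arity S a) h \<in> Sym (arity S a)"
proof -
  let ?n = "arity S a"
  have a: "a \<in> ops S" and bij: "bij_betw h {1..?n} ((\<lambda>i. \<langle>a, Idx i\<rangle>) ` {1..?n})"
    using h by (simp_all add: fibre_enum_iota_a)
  have "bij_betw pi2 ((\<lambda>i. \<langle>a, Idx i\<rangle>) ` {1..?n}) {1..?n}"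
    by (rule bij_betwI[of _ _ _ "\<lambda>i. \<langle>a, Idx i\<rangle>"]) auto
  with bij have "bij_betw (pi2 \<circ> h) {1..?n} {1..?n}"
    using bij_betw_trans by blast
  then have "bij_betw (pi2_comp ?n h) {1..?n} {1..?n}"
    using bij_betw_cong[of "{1..?n}" "pi2 \<circ> h" "pi2_comp ?n h"] by (simp add: pi2_comp_def)
  then show ?thesis
    by (auto simp: pi2_comp_def intro: bij_imp_permutes)
qed

text \<open>The equivariance of \<open>Phi\<close> on operations. Outside (n] both sides are the
  identity, since \<tau> fixes these points.\<close>

lemma pi2_comp_comp_Sym:
  "\<tau> \<in> Sym n \<Longrightarrow> pi2_comp n (h \<circ> \<tau>) = pi2_comp n h \<circ> \<tau>"
  using Sym_range[of \<tau> n] permutes_not_in[of \<tau> "{1..n}"]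
  by (auto simp: pi2_comp_def fun_eq_iff)

text \<open>The inverse reattaches \<open>a\<close> as first coordinate and replaces the default of
  a permutation, the identity, by the default of an extensional function.\<close>

lemma bij_betw_pi2_comp:
  assumes a: "a \<in> ops S"
  shows "bij_betw (pi2_comp (arity S a)) {h. fibre_enum (iota_a_ob S) a h} (Sym (arity S a))"
proof (rule bij_betwI[where g = "\<lambda>\<tau>. \<lambda>i\<in>{1..arity S a}. \<langle>a, Idx (\<tau> i)\<rangle>"])
  let ?n = "arity S a" and ?F = "(\<lambda>i. \<langle>a, Idx i\<rangle>) ` {1..arity S a}"
  show "pi2_comp ?n \<in> {h. fibre_enum (iota_a_ob S) a h} \<rightarrow> Sym ?n"
    using pi2_comp_Sym by blast
  show "(\<lambda>\<tau>. \<lambda>i\<in>{1..?n}. \<langle>a, Idx (\<tau> i)\<rangle>) \<in> Sym ?n \<rightarrow> {h. fibre_enum (iota_a_ob S) a h}"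
  proof
    fix \<tau> assume "\<tau> \<in> Sym ?n"
    then have "bij_betw \<tau> {1..?n} {1..?n}"
      using permutes_imp_bij by blast
    moreover have "bij_betw (\<lambda>i. \<langle>a, Idx i\<rangle>) {1..?n} ?F"
      by (auto simp: bij_betw_def inj_on_def)
    ultimately have "bij_betw ((\<lambda>i. \<langle>a, Idx i\<rangle>) \<circ> \<tau>) {1..?n} ?F"
      using bij_betw_trans by blast
    then have "bij_betw (\<lambda>i\<in>{1..?n}. \<langle>a, Idx (\<tau> i)\<rangle>) {1..?n} ?F"
      by (subst bij_betw_cong[where g = "(\<lambda>i. \<langle>a, Idx i\<rangle>) \<circ> \<tau>"]) auto
    then show "(\<lambda>i\<in>{1..?n}. \<langle>a, Idx (\<tau> i)\<rangle>) \<in> {h. fibre_enum (iota_a_ob S) a h}"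
      using a by (simp add: fibre_enum_iota_a)
  qed
  show "(\<lambda>i\<in>{1..?n}. \<langle>a, Idx (pi2_comp ?n h i)\<rangle>) = h"
    if "h \<in> {h. fibre_enum (iota_a_ob S) a h}" for h
  proof -
    have "h \<in> extensional {1..?n}"
      using that by (simp add: fibre_enum_iota_a)
    moreover have "(\<lambda>i\<in>{1..?n}. \<langle>a, Idx (pi2_comp ?n h i)\<rangle>) i = h i" if "i \<in> {1..?n}" for i
      using pi2_comp_nth[of S a h i] \<open>h \<in> {h. fibre_enum (iota_a_ob S) a h}\<close> that by simp
    ultimately show ?thesis
      by (intro extensionalityI[of _ "{1..?n}"]) simp_all
  qed
  show "pi2_comp ?n (\<lambda>i\<in>{1..?n}. \<langle>a, Idx (\<tau> i)\<rangle>) = \<tau>" if "\<tau> \<in> Sym ?n" for \<tau>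
    using that permutes_not_in[of \<tau> "{1..?n}"] by (auto simp: pi2_comp_def fun_eq_iff)
qed

lemma is_andiag_mor_Phi:
  assumes S: "is_siga S"
  shows "is_andiag_mor (K_diag_ob (iota_a_ob S)) (iota_s_ob (K_sig_ob S)) (Phi S)"
proof -
  let ?P = "K_diag_ob (iota_a_ob S)" and ?Q = "iota_s_ob (K_sig_ob S)"
  have card: "a \<in> ops S" "card (pfib (iota_a_ob S) a) = arity S a"
    if "fibre_enum (iota_a_ob S) a h" for a h
    using that by (simp_all add: fibre_enum_iota_a card_pfib_iota_a)
  note [simp] = pi2_comp_Sym[simplified] pi2_comp_comp_Sym[simplified]
  have act: "fibre_enum (iota_a_ob S) a (h \<circ> \<tau>)"
    if "fibre_enum (iota_a_ob S) a h" "\<tau> \<in> Sym (arity S a)" for a h \<tau>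
    using fibre_enum_Sym card[OF that(1)] that by metis
  \<comment> \<open>The output sort of the operation \<open>\<langle>a, Prm \<tau>\<rangle>\<close>
    is \<open>bd S a (\<tau> 0)\<close>, so agreement of outputs rests on this default
    value.\<close>
  have zero: "pi2_comp n h 0 = 0" for n and h :: "nat \<Rightarrow> 'a elem"
    by (simp add: pi2_comp_def)
  have P: "is_andiag ?P"
    by (intro is_andiag_K_diag is_pdiag_iota_a S)
  have Q: "is_andiag ?Q"
    using S by (intro is_andiag_iota_s is_sigs_K_sig)
  have "is_equivariant (anA ?P) (anA ?Q)
      (\<lambda>x\<in>crr (anA ?P). case x of \<langle>a, Fn h\<rangle> \<Rightarrow> \<langle>a, Prm (pi2_comp (arity S a) h)\<rangle>)"
    using card act by (auto simp: is_equivariant_def)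
  moreover have "is_equivariant (anE ?P) (anE ?Q)
      (\<lambda>e\<in>crr (anE ?P). case e of \<langle>\<langle>a, Fn h\<rangle>, Idx i\<rangle> \<Rightarrow>
        \<langle>\<langle>a, Prm (pi2_comp (arity S a) h)\<rangle>, Idx i\<rangle>)"
    using card act Sym_inv_mem by (auto simp: is_equivariant_def)
  \<comment> \<open>Agreement of input sorts: the element of the fibre listed at position
    \<open>i\<close> is the input with number \<open>pi2_comp (arity S a) h i\<close>.\<close>
  moreover have "ps (iota_a_ob S) (h i) = bd S a (pi2_comp (arity S a) h i)"
    if "fibre_enum (iota_a_ob S) a h" "i \<in> {1..arity S a}" for a h i
    by (subst pi2_comp_nth[OF that]) simp
  moreover have "bd S a i \<in> sorts S" if "a \<in> ops S" "i \<le> arity S a" for a i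
    using S that by (rule is_sigaD)
  moreover have "pi2_comp (arity S a) h i \<le> arity S a"
    if "fibre_enum (iota_a_ob S) a h" "i \<in> {1..arity S a}" for a h i
    using Sym_range[OF pi2_comp_Sym[OF that(1)]] that(2) by auto
  ultimately show ?thesis
    using card zero
    by (auto simp: Phi_def fcomp_def K_diag_def iota_a_def is_andiag_mor_iff[OF P Q] delta_map_def)
qed

lemma is_iso_Phi:
  assumes S: "is_siga S"
  shows "is_iso AnDiag (K_diag_ob (iota_a_ob S)) (iota_s_ob (K_sig_ob S)) (Phi S)"
proof -
  let ?P = "K_diag_ob (iota_a_ob S)" and ?Q = "iota_s_ob (K_sig_ob S)"
  obtain f g u where Phi: "Phi S = (f, g, u)"
    by (cases "Phi S")
  have f: "f \<langle>a, Fn h\<rangle> = \<langle>a, Prm (pi2_comp (arity S a) h)\<rangle>"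
    if "fibre_enum (iota_a_ob S) a h" for a h
    using Phi that by (auto simp: Phi_def fcomp_def K_diag_def iota_a_def Let_def)
  have P: "is_andiag ?P"
    by (intro is_andiag_K_diag is_pdiag_iota_a S)
  have Q: "is_andiag ?Q"
    using S by (intro is_andiag_iota_s is_sigs_K_sig)
  have "bij_betw f (crr (anA ?P)) (crr (anA ?Q))"
    unfolding bij_betw_def
  proof
    show "inj_on f (crr (anA ?P))"
    proof (rule inj_onI)
      fix x y assume "x \<in> crr (anA ?P)" "y \<in> crr (anA ?P)" "f x = f y"
      then obtain a h h' where ah: "x = \<langle>a, Fn h\<rangle>" "y = \<langle>a, Fn h'\<rangle>"
        and h: "fibre_enum (iota_a_ob S) a h" "fibre_enum (iota_a_ob S) a h'"
        and eq: "pi2_comp (arity S a) h = pi2_comp (arity S a) h'"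
        by (auto simp: f)
      have "a \<in> ops S"
        using h(1) by (simp add: fibre_enum_iota_a)
      then have "h = h'"
        using bij_betw_imp_inj_on[OF bij_betw_pi2_comp] h eq by (auto dest: inj_onD)
      with ah show "x = y"
        by simp
    qed
    show "f ` crr (anA ?P) = crr (anA ?Q)"
    proof
      show "f ` crr (anA ?P) \<subseteq> crr (anA ?Q)"
        using pi2_comp_Sym by (fastforce simp: f fibre_enum_def)
    next
      show "crr (anA ?Q) \<subseteq> f ` crr (anA ?P)"
      proof
        fix y assume "y \<in> crr (anA ?Q)"
        then obtain a \<tau> where y: "y = \<langle>a, Prm \<tau>\<rangle>" "a \<in> ops S" "\<tau> \<in> Sym (arity S a)"
          by auto
        then obtain h where "fibre_enum (iota_a_ob S) a h" "\<tau> = pi2_comp (arity S a) h"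
          using bij_betw_imp_surj_on[OF bij_betw_pi2_comp[OF y(2)]] by blast
        then have "y = f \<langle>a, Fn h\<rangle>" "\<langle>a, Fn h\<rangle> \<in> crr (anA ?P)"
          using y by (simp_all add: f)
        then show "y \<in> f ` crr (anA ?P)"
          by blast
      qed
    qed
  qed
  moreover have "bij_betw u (asorts ?P) (asorts ?Q)"
    using Phi by (auto simp: Phi_def fcomp_def Let_def bij_betw_def inj_on_def)
  moreover have "is_andiag_mor ?P ?Q (f, g, u)"
    using is_andiag_mor_Phi[OF S] Phi by simp
  ultimately show ?thesis
    unfolding Phi by (intro is_iso_AnDiagI P Q)
qed

text \<open>All the maps involved keep the position \<open>i\<close>, so the components on
  operations and on E both come down to one equation for \<open>pi2_comp\<close> of the transported
  enumeration.\<close>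

lemma Phi_natural:
  assumes "is_siga_mor S T x"
  shows "cmp AnDiag (K_diag_ob (iota_a_ob S)) (K_diag_ob (iota_a_ob T)) (iota_s_ob (K_sig_ob T))
      (Phi T) (FAr (K_diag \<circ>\<^sub>F iota_a) S T x) =
    cmp AnDiag (K_diag_ob (iota_a_ob S)) (iota_s_ob (K_sig_ob S)) (iota_s_ob (K_sig_ob T))
      (FAr (iota_s \<circ>\<^sub>F K_sig) S T x) (Phi S)"
proof -
  obtain f \<sigma> u where x: "x = (f, \<sigma>, u)"
    by (cases x)
  note m = is_siga_morD[OF assms[unfolded x]]
  obtain g where g: "FAr iota_a S T x = (f, g, u)"
      "\<And>a i. a \<in> ops S \<Longrightarrow> i \<in> {1..arity S a} \<Longrightarrow> g \<langle>a, Idx i\<rangle> = \<langle>f a, Idx (inv (\<sigma> a) i)\<rangle>"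
    by (auto simp: iota_a_def x)
  have pm: "is_pdiag_mor (iota_a_ob S) (iota_a_ob T) (f, g, u)"
    using iota_a_mor assms g(1) x by metis
  \<comment> \<open>\<open>Phi T\<close> refers to \<open>arity T (f a)\<close> and
    \<open>K_diag\<close> to the cardinalities of fibres; all of them equal
    \<open>arity S a\<close>, so one index range serves both composites.\<close>
  have fac: "a \<in> ops S" "card (pfib (iota_a_ob S) a) = arity S a"
      "card (pfib (iota_a_ob T) (f a)) = arity S a" "arity T (f a) = arity S a"
      "pi2_comp (arity S a) h \<in> Sym (arity S a)"
      "fibre_enum (iota_a_ob T) (f a) (compose {1..arity S a} g h)"
      "pi2_comp (arity S a) (compose {1..arity S a} g h) = inv (\<sigma> a) \<circ> pi2_comp (arity S a) h"
    if h: "fibre_enum (iota_a_ob S) a h" for a h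
  proof -
    show a: "a \<in> ops S"
      using h by (simp add: fibre_enum_iota_a)
    show card: "card (pfib (iota_a_ob S) a) = arity S a"
        "card (pfib (iota_a_ob T) (f a)) = arity S a" "arity T (f a) = arity S a"
      using a m by (simp_all add: card_pfib_iota_a)
    show p: "pi2_comp (arity S a) h \<in> Sym (arity S a)"
      by (rule pi2_comp_Sym[OF h])
    show "fibre_enum (iota_a_ob T) (f a) (compose {1..arity S a} g h)"
      using fibre_enum_compose[OF pm h] card by simp
    show "pi2_comp (arity S a) (compose {1..arity S a} g h) = inv (\<sigma> a) \<circ> pi2_comp (arity S a) h"
    proof
      fix i
      show "pi2_comp (arity S a) (compose {1..arity S a} g h) i
          = (inv (\<sigma> a) \<circ> pi2_comp (arity S a) h) i"
      proof (cases "i \<in> {1..arity S a}")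
        case True
        \<comment> \<open>Here \<open>h i\<close> is the input of \<open>a\<close> with number
          \<open>pi2_comp (arity S a) h i\<close>, which \<open>g\<close> renumbers by
          \<open>inv (\<sigma> a)\<close>.\<close>
        then have "g (h i) = \<langle>f a, Idx (inv (\<sigma> a) (pi2_comp (arity S a) h i))\<rangle>"
          using pi2_comp_nth[OF h True] g(2)[OF a] Sym_range[OF p] by metis
        with True show ?thesis
          by (simp add: pi2_comp_def compose_eq)
      next
        case False
        \<comment> \<open>Outside the range \<open>pi2_comp\<close> is the identity on both sides,
          and \<open>inv (\<sigma> a)\<close> fixes \<open>i\<close>.\<close>
        then show ?thesis
          using permutes_not_in[of "inv (\<sigma> a)" "{1..arity S a}" i] Sym_inv[OF m(3)[OF a]]
          by (auto simp: pi2_comp_def)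
      qed
    qed
  qed
  have u: "u \<in> sorts S \<rightarrow>\<^sub>E sorts T"
    using assms x by (simp add: is_siga_mor_def)
  have "compose (sorts S) (\<lambda>x\<in>sorts T. x) u = compose (sorts S) u (\<lambda>x\<in>sorts S. x)"
    using u by (auto simp: compose_def intro!: restrict_ext)
  then show ?thesis
    using fac m g(1)
    by (auto simp: AnDiag_def fcomp_def Phi_def K_diag_def iota_s_def K_sig_def Let_def x
        compose_def[of "crr _"] iota_a_def[THEN arg_cong, of FOb] intro!: restrict_ext)
qed

theorem proposition7p17:
  shows "is_natural_isomorphism
           (Sig_a :: (('x elem, 'o) siga, ('x elem, 'o) siga_mor) cat)
           (AnDiag :: (('x elem, 'x elem, 'o) andiag, ('x elem, 'x elem, 'o) diag_mor) cat)
           (K_diag \<circ>\<^sub>F iota_a) (iota_s \<circ>\<^sub>F K_sig) Phi"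
proof -
  have "FOb (K_diag \<circ>\<^sub>F iota_a) = (\<lambda>S :: ('x elem, 'o) siga. K_diag_ob (iota_a_ob S))"
    and "FOb (iota_s \<circ>\<^sub>F K_sig) = (\<lambda>S :: ('x elem, 'o) siga. iota_s_ob (K_sig_ob S))"
    by (simp_all add: fcomp_def K_diag_def iota_a_def iota_s_def K_sig_def)
  moreover have "Phi S \<in> Hom AnDiag (K_diag_ob (iota_a_ob S)) (iota_s_ob (K_sig_ob S))"
    if "is_siga S" for S :: "('x elem, 'o) siga"
    using is_andiag_mor_Phi[OF that] by (simp add: AnDiag_def)
  moreover have "S \<in> Ob Sig_a \<longleftrightarrow> is_siga S" "x \<in> Hom Sig_a S T \<longleftrightarrow> is_siga_mor S T x"
    for S T :: "('x elem, 'o) siga" and x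
    by (simp_all add: Sig_a_def)
  ultimately show ?thesis
    unfolding is_natural_isomorphism_def is_natural_transformation_def
    using is_functor_fcomp[OF is_functor_iota_a is_functor_K_diag]
      is_functor_fcomp[OF is_functor_K_sig is_functor_iota_s] is_iso_Phi Phi_natural
    by auto
qed

end
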